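(* Let $P$ be a strangely ordered (regular) cycle on the triod $T$ with rotation number $\frac pq\neq\frac13$, $\gcd(p,q)=1$, and rotation pair $(kp,kq)$, $k\in\mathbb N$; let $f$ be the $P$-linear map and let $\psi$ be the code function of $P$ (with respect to some base point $x_0\in P$). Let $\mathbb S$ be the circle, viewed as $[0,1]$ with its end-points identified, and let $g:\mathbb S\to\mathbb S$, $g(x)=x+\frac pq \pmod 1$. Then there exists a continuous map $\Phi:T\to\mathbb S$ such that $\Phi(f(x))=g(\Phi(x))$ for every $x\in P$, and such that $\Phi$ is monotone on each coherent strip of $P$ (that is, on each coherent strip, $\Phi$, regarded as taking values in $[0,1)$, is a weakly monotone function of the distance to the branching point).
   Context: **Triod and patterns.** The triod is $T=\{z\in\mathbb C: z^3\in[0,1]\}$ with branching point $a=0$; the three components of $T\setminus\{a\}$ are its branches. $\mathcal U$ is the set of continuous maps $f:T\to T$ whose unique fixed point is $a$. For $x,y\in T$ write $x>y$ if $x,y$ lie on the same branch and $x$ is farther from $a$ than $y$; $x\geqslant y$ means $x>y$ or $x=y$. $[A]$ denotes the convex hull of $A$ in $T$ (smallest closed connected set containing $A$); $[x,y]$ is the convex hull of $\{x,y\}$. A cycle is a periodic orbit $P\subset T\setminus\{a\}$ of some $f\in\mathcal U$. Two cycles $P,Q$ (of maps $f,g\in\mathcal U$) are equivalent if there is a homeomorphism $h:[P]\to[Q]$ preserving each branch, with $h(P)=Q$ and $h\circ f=g\circ h$ on $P$; an equivalence class is a pattern, and $P$ exhibits its class. A pattern $A$ forces a pattern $B$ if every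 $f\in\mathcal U$ having a cycle of pattern $A$ also has a cycle of pattern $B$. A cycle/pattern is primitive if all its points lie on different branches. A pattern is regular if it does not force a primitive pattern of period $2$; a cycle is regular if its pattern is. For a cycle $P$, the $P$-linear map is the map in $\mathcal U$ that agrees with the given map on $P$, fixes $a$, is affine (with respect to arc length on $T$) on each component of $[P]\setminus(P\cup\{a\})$, and is constant on each component of $T\setminus[P]$. **Canonical ordering.** A regular cycle $P$ has points on all three branches, and the branches can be cyclically labelled $b_0,b_1,b_2$ (indices mod 3) so that for every $i$ the point $p_i$ of $P$ in $b_i$ closest to $a$ is mapped into $b_{i+1}$. This labelling (canonical ordering) is always used. **Rotation numbers.** For a cycle $P$ with $P$-linear map $f$, let $G_P$ be the oriented graph with vertex set $P$ and an arrow $x\to y$ iff there is $z\in T$ with $x\geqslant z$ and $f(z)\geqslant y$. If $u\in b_i$, $v\in b_j$, $j\equiv i+k \pmod 3$, $k\in\{0,1,2\}$, the displacement of an arrow $u\to v$ is $d(u\to v)=\frac k3$. For a loop $\Gamma$ in $G_P$ of length $|\Gamma|$ let $d(\Gamma)$ be the sum of displacements along $\Gamma$ (an integer); its rotation pair is $(d(\Gamma),|\Gamma|)$ and its rotation number is $d(\Gamma)/|\Gamma|$. The rotation pair and rotation number of $P$ and of its pattern $\pi$ are those of the loop $x\to f(x)\to\dots\to f^{n-1}(x)\to x$ ($x\in P$, $n$ the period of $P$). The rotation interval $I_\pi$ forced by $\pi$ is the closure of the set of rotation numbers of all loops of $G_P$; it is a closed (possibly degenerate) interval. $\pi$ is a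 frontier pattern if $\rho(\pi)$ is an end-point of $I_\pi$. **Triod twists, block structure, strangely ordered.** A regular pattern is a triod twist pattern if it does not force another pattern with the same rotation number. A cycle $P$ with $P$-linear map $f$ has a block structure over a cycle $Q$ (of $f$), $Q$ of period $m$, if $P$ can be divided into subsets $P_1,\dots,P_m$ (blocks) of the same cardinality such that the sets $[P_i]$ are pairwise disjoint, none contains $a$, each $[P_i]$ contains exactly one point $x_i$ of $Q$, and $f(P_i)=P_j$ whenever $f(x_i)=x_j$. A pattern $A$ has a block structure over a pattern $B$ if some cycle of pattern $A$ has a block structure over a cycle of pattern $B$. A pattern (and any cycle exhibiting it) is strangely ordered if it is a frontier pattern that is neither a triod twist pattern nor has a block structure over a triod twist pattern. **Code function.** Let $P$ be a cycle with rotation number $\rho\ne\frac13$. Choose a base point $x_0\in P$, put $\psi(x_0)=0$ and $\psi(f^k(x_0))=k\rho-\lfloor t_k\rfloor$ for $k\in\mathbb N$, where $t_k=\sum_{j=0}^{k-1}d(f^j(x_0)\to f^{j+1}(x_0))$. This gives a well-defined $\psi:P\to\mathbb R$. **Coherent strips.** For $x,y\in P$ let $x\sim y$ if $x$ and $y$ lie on the same branch and all points of $P$ lying in $[x,y]$ have the same integer part $\lfloor\psi(\cdot)\rfloor$ of the code. This is an equivalence relation on $P$; the convex hulls of its equivalence classes are the coherent strips of $P$. *)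

theory Defs
  imports "HOL-Analysis.Analysis"
begin

section \<open>The triod\<close>

definition triod :: "complex set" where
  "triod = {z. \<exists>r\<in>{0..1::real}. z ^ 3 = of_real r}"

definition branches :: "complex set set" where
  "branches = components (triod - {0})"

definition same_branch :: "complex \<Rightarrow> complex \<Rightarrow> bool" where
  "same_branch x y \<longleftrightarrow> (\<exists>B\<in>branches. x \<in> B \<and> y \<in> B)"

definition farther :: "complex \<Rightarrow> complex \<Rightarrow> bool" where
  "farther x y \<longleftrightarrow> same_branch x y \<and> norm x > norm y"

definition farther_eq :: "complex \<Rightarrow> complex \<Rightarrow> bool" where
  "farther_eq x y \<longleftrightarrow> farther x y \<or> x = y"

definition triod_hull :: "complex set \<Rightarrow> complex set" where
  "triod_hull A = (\<lambda>C. C \<subseteq> triod \<and> closed C \<and> connected C) hull A"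

text \<open>Arc length distance: two points on different branches are joined through the branching
  point, whose distance to \<open>x\<close> is \<open>norm x\<close>.\<close>

definition triod_dist :: "complex \<Rightarrow> complex \<Rightarrow> real" where
  "triod_dist x y = (if same_branch x y then \<bar>norm x - norm y\<bar> else norm x + norm y)"

text \<open>Maps are total functions on the complex plane; only their values on the triod matter.\<close>

definition triod_maps :: "(complex \<Rightarrow> complex) set" where
  "triod_maps = {f. continuous_on triod f \<and> f \<in> triod \<rightarrow> triod \<and> (\<forall>z\<in>triod. f z = z \<longleftrightarrow> z = 0)}"


section \<open>Cycles, patterns, forcing\<close>

definition is_cycle :: "(complex \<Rightarrow> complex) \<Rightarrow> complex set \<Rightarrow> bool" where
  "is_cycle f P \<longleftrightarrow> f \<in> triod_maps \<and> P \<subseteq> triod - {0} \<and>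
     (\<exists>x. \<exists>n>0. (f ^^ n) x = x \<and> P = range (\<lambda>k. (f ^^ k) x))"

text \<open>A cycle is represented together with a map of which it is a periodic orbit.\<close>

type_synonym cycle = "(complex \<Rightarrow> complex) \<times> complex set"

definition cycle_equiv :: "cycle rel" where
  "cycle_equiv = {((f, P), (g, Q)). is_cycle f P \<and> is_cycle g Q \<and>
     (\<exists>h h'. homeomorphism (triod_hull P) (triod_hull Q) h h' \<and>
        (\<forall>B\<in>branches. h ` (triod_hull P \<inter> B) = triod_hull Q \<inter> B) \<and>
        h ` P = Q \<and> (\<forall>x\<in>P. h (f x) = g (h x)))}"

definition patterns :: "cycle set set" where
  "patterns = {(f, P). is_cycle f P} // cycle_equiv"

definition pattern_of :: "(complex \<Rightarrow> complex) \<Rightarrow> complex set \<Rightarrow> cycle set" where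
  "pattern_of f P = cycle_equiv `` {(f, P)}"

definition forces :: "cycle set \<Rightarrow> cycle set \<Rightarrow> bool" where
  "forces A B \<longleftrightarrow> (\<forall>f\<in>triod_maps. (\<exists>P. (f, P) \<in> A) \<longrightarrow> (\<exists>Q. (f, Q) \<in> B))"

definition primitive_cycle :: "complex set \<Rightarrow> bool" where
  "primitive_cycle P \<longleftrightarrow> (\<forall>x\<in>P. \<forall>y\<in>P. x \<noteq> y \<longrightarrow> \<not> same_branch x y)"

definition regular_pattern :: "cycle set \<Rightarrow> bool" where
  "regular_pattern A \<longleftrightarrow> A \<in> patterns \<and>
     \<not> (\<exists>B\<in>patterns. (\<exists>(f, P)\<in>B. primitive_cycle P \<and> card P = 2) \<and> forces A B)"


section \<open>The P-linear map\<close>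

text \<open>On a connected subset of a branch, multiplying arc length distances by a constant means
  running along a geodesic of the triod (possibly through the branching point) with constant speed.\<close>

definition triod_affine_on :: "complex set \<Rightarrow> (complex \<Rightarrow> complex) \<Rightarrow> bool" where
  "triod_affine_on C f \<longleftrightarrow> (\<exists>L. \<forall>x\<in>C. \<forall>y\<in>C. triod_dist (f x) (f y) = L * triod_dist x y)"

text \<open>\<open>P_linear F P f\<close>: \<open>f\<close> is the \<open>P\<close>-linear map of the cycle \<open>P\<close> of \<open>F\<close>; this determines \<open>f\<close> on
  the triod.\<close>

definition P_linear :: "(complex \<Rightarrow> complex) \<Rightarrow> complex set \<Rightarrow> (complex \<Rightarrow> complex) \<Rightarrow> bool" where
  "P_linear F P f \<longleftrightarrow> f \<in> triod_maps \<and> (\<forall>x\<in>P. f x = F x) \<and> f 0 = 0 \<and>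
     (\<forall>C\<in>components (triod_hull P - (P \<union> {0})). triod_affine_on C f) \<and>
     (\<forall>C\<in>components (triod - triod_hull P). f constant_on C)"


section \<open>Rotation numbers\<close>

text \<open>The branches are labelled by \<open>b 0\<close>, \<open>b 1\<close>, \<open>b 2\<close>. For a regular cycle the canonical labelling
  exists and is unique up to a cyclic shift, which does not affect displacements.\<close>

definition canonical_labelling ::
    "(complex \<Rightarrow> complex) \<Rightarrow> complex set \<Rightarrow> (nat \<Rightarrow> complex set) \<Rightarrow> bool" where
  "canonical_labelling f P b \<longleftrightarrow> bij_betw b {..<3} branches \<and>
     (\<forall>i<3. \<exists>p\<in>P \<inter> b i. (\<forall>x\<in>P \<inter> b i. norm p \<le> norm x) \<and> f p \<in> b (Suc i mod 3))"

definition label :: "(complex \<Rightarrow> complex) \<Rightarrow> complex set \<Rightarrow> complex \<Rightarrow> nat" where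
  "label f P u = (THE i. i < 3 \<and> u \<in> (SOME b. canonical_labelling f P b) i)"

definition displacement ::
    "(complex \<Rightarrow> complex) \<Rightarrow> complex set \<Rightarrow> complex \<Rightarrow> complex \<Rightarrow> real" where
  "displacement f P u v = real (THE k. k < 3 \<and> label f P v = (label f P u + k) mod 3) / 3"

text \<open>A loop \<open>v\<^sub>0 \<rightarrow> v\<^sub>1 \<rightarrow> \<dots> \<rightarrow> v\<^sub>n\<^sub>-\<^sub>1 \<rightarrow> v\<^sub>0\<close> of length \<open>n\<close> is given by the list of its \<open>n\<close> vertices.
  The graph is that of the cycle \<open>P\<close> with \<open>P\<close>-linear map \<open>f\<close>.\<close>

definition arrow :: "(complex \<Rightarrow> complex) \<Rightarrow> complex \<Rightarrow> complex \<Rightarrow> bool" where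
  "arrow f x y \<longleftrightarrow> (\<exists>z\<in>triod. farther_eq x z \<and> farther_eq (f z) y)"

definition is_loop :: "(complex \<Rightarrow> complex) \<Rightarrow> complex set \<Rightarrow> complex list \<Rightarrow> bool" where
  "is_loop f P vs \<longleftrightarrow> vs \<noteq> [] \<and> set vs \<subseteq> P \<and>
     (\<forall>i<length vs. arrow f (vs ! i) (vs ! (Suc i mod length vs)))"

definition loop_pair ::
    "(complex \<Rightarrow> complex) \<Rightarrow> complex set \<Rightarrow> complex list \<Rightarrow> real \<times> nat" where
  "loop_pair f P vs =
     (\<Sum>i<length vs. displacement f P (vs ! i) (vs ! (Suc i mod length vs)), length vs)"

definition loop_rotation_number ::
    "(complex \<Rightarrow> complex) \<Rightarrow> complex set \<Rightarrow> complex list \<Rightarrow> real" where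
  "loop_rotation_number f P vs = fst (loop_pair f P vs) / real (snd (loop_pair f P vs))"

definition orbit_loop :: "(complex \<Rightarrow> complex) \<Rightarrow> complex set \<Rightarrow> complex list" where
  "orbit_loop f P = map (\<lambda>i. (f ^^ i) (SOME x. x \<in> P)) [0..<card P]"

definition rotation_pair :: "(complex \<Rightarrow> complex) \<Rightarrow> complex set \<Rightarrow> real \<times> nat" where
  "rotation_pair f P = loop_pair f P (orbit_loop f P)"

definition rotation_number :: "(complex \<Rightarrow> complex) \<Rightarrow> complex set \<Rightarrow> real" where
  "rotation_number f P = loop_rotation_number f P (orbit_loop f P)"

definition pattern_rotation_number :: "cycle set \<Rightarrow> real" where
  "pattern_rotation_number A = (THE r. \<forall>(f, P)\<in>A. rotation_number f P = r)"

definition rotation_interval :: "(complex \<Rightarrow> complex) \<Rightarrow> complex set \<Rightarrow> real set" where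
  "rotation_interval f P = closure (loop_rotation_number f P ` {vs. is_loop f P vs})"

text \<open>The end-points of the closed interval \<open>I\<close> are \<open>Inf I\<close> and \<open>Sup I\<close>.\<close>

definition frontier_pattern :: "cycle set \<Rightarrow> bool" where
  "frontier_pattern A \<longleftrightarrow> A \<in> patterns \<and>
     (\<exists>(F, P)\<in>A. \<exists>f. P_linear F P f \<and>
        pattern_rotation_number A \<in> {Inf (rotation_interval f P), Sup (rotation_interval f P)})"


section \<open>Triod twists, block structure, strangely ordered cycles\<close>

definition triod_twist :: "cycle set \<Rightarrow> bool" where
  "triod_twist A \<longleftrightarrow> regular_pattern A \<and>
     \<not> (\<exists>B\<in>patterns. forces A B \<and> B \<noteq> A \<and>
          pattern_rotation_number B = pattern_rotation_number A)"

text \<open>Here \<open>f\<close> is the \<open>P\<close>-linear map.\<close>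

definition cycle_block_structure ::
    "(complex \<Rightarrow> complex) \<Rightarrow> complex set \<Rightarrow> complex set \<Rightarrow> bool" where
  "cycle_block_structure f P Q \<longleftrightarrow> is_cycle f P \<and> is_cycle f Q \<and>
     (\<exists>(K :: nat \<Rightarrow> complex set) x c.
        P = (\<Union>i<card Q. K i) \<and>
        (\<forall>i<card Q. card (K i) = c) \<and>
        disjoint_family_on (\<lambda>i. triod_hull (K i)) {..<card Q} \<and>
        (\<forall>i<card Q. 0 \<notin> triod_hull (K i) \<and> triod_hull (K i) \<inter> Q = {x i}) \<and>
        (\<forall>i<card Q. \<forall>j<card Q. f (x i) = x j \<longrightarrow> f ` K i = K j))"

definition pattern_block_structure :: "cycle set \<Rightarrow> cycle set \<Rightarrow> bool" where
  "pattern_block_structure A B \<longleftrightarrow>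
     (\<exists>(F, P)\<in>A. \<exists>f Q. P_linear F P f \<and> (f, Q) \<in> B \<and> cycle_block_structure f P Q)"

definition strangely_ordered :: "cycle set \<Rightarrow> bool" where
  "strangely_ordered A \<longleftrightarrow> frontier_pattern A \<and> \<not> triod_twist A \<and>
     \<not> (\<exists>B\<in>patterns. triod_twist B \<and> pattern_block_structure A B)"


section \<open>Code function and coherent strips\<close>

definition code_function ::
    "(complex \<Rightarrow> complex) \<Rightarrow> complex set \<Rightarrow> complex \<Rightarrow> (complex \<Rightarrow> real) \<Rightarrow> bool" where
  "code_function f P x0 \<psi> \<longleftrightarrow> \<psi> x0 = 0 \<and>
     (\<forall>k. \<psi> ((f ^^ k) x0) = real k * rotation_number f P -
        of_int \<lfloor>\<Sum>j<k. displacement f P ((f ^^ j) x0) ((f ^^ Suc j) x0)\<rfloor>)"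

definition strip_rel :: "complex set \<Rightarrow> (complex \<Rightarrow> real) \<Rightarrow> complex rel" where
  "strip_rel P \<psi> = {(x, y). x \<in> P \<and> y \<in> P \<and> same_branch x y \<and>
     (\<exists>m. \<forall>z\<in>P \<inter> triod_hull {x, y}. \<lfloor>\<psi> z\<rfloor> = m)}"

definition coherent_strips :: "complex set \<Rightarrow> (complex \<Rightarrow> real) \<Rightarrow> complex set set" where
  "coherent_strips P \<psi> = triod_hull ` (P // strip_rel P \<psi>)"


section \<open>The circle\<close>

text \<open>The circle is \<open>[0,1]\<close> with its end-points identified: its points are the representatives in
  \<open>[0,1)\<close>, its topology is the quotient topology along \<open>frac\<close>, which sends \<open>1\<close> to \<open>0\<close> and fixes
  the points of \<open>[0,1)\<close>.\<close>

definition circle :: "real topology" where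
  "circle = topology (\<lambda>U. U \<subseteq> {0..<1} \<and>
     openin (top_of_set {0..1}) {x \<in> {0..1}. frac x \<in> U})"

lemma openin_circle:
  "openin circle U \<longleftrightarrow> U \<subseteq> {0..<1} \<and> openin (top_of_set {0..1}) {x \<in> {0..1}. frac x \<in> U}"
proof -
  have "istopology (\<lambda>U. U \<subseteq> {0..<1::real} \<and>
      openin (top_of_set {0..1}) {x \<in> {0..1}. frac x \<in> U})"
    unfolding istopology_def
  proof (intro conjI allI impI; (elim conjE)?)
    fix S T :: "real set"
    assume "openin (top_of_set {0..1}) {x \<in> {0..1}. frac x \<in> S}"
      and "openin (top_of_set {0..1}) {x \<in> {0..1}. frac x \<in> T}"
    then have "openin (top_of_set {0..1})
        ({x \<in> {0..1}. frac x \<in> S} \<inter> {x \<in> {0..1}. frac x \<in> T})"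
      by (rule openin_Int)
    also have "{x \<in> {0..1}. frac x \<in> S} \<inter> {x \<in> {0..1}. frac x \<in> T} =
        {x \<in> {0..1}. frac x \<in> S \<inter> T}"
      by auto
    finally show "openin (top_of_set {0..1}) {x \<in> {0..1}. frac x \<in> S \<inter> T}" .
  next
    fix \<K> :: "real set set"
    assume "\<forall>K\<in>\<K>. K \<subseteq> {0..<1} \<and> openin (top_of_set {0..1}) {x \<in> {0..1}. frac x \<in> K}"
    then have "openin (top_of_set {0..1}) (\<Union>K\<in>\<K>. {x \<in> {0..1}. frac x \<in> K})"
      by blast
    also have "(\<Union>K\<in>\<K>. {x \<in> {0..1}. frac x \<in> K}) = {x \<in> {0..1}. frac x \<in> \<Union>\<K>}"
      by auto
    finally show "openin (top_of_set {0..1}) {x \<in> {0..1}. frac x \<in> \<Union>\<K>}" .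
  qed auto
  then show ?thesis
    by (simp add: circle_def topology_inverse')
qed

lemma topspace_circle: "topspace circle = {0..<1}"
proof -
  have "{x \<in> {0..1::real}. frac x \<in> {0..<1}} = {0..1}"
    by (auto simp: frac_ge_0 frac_lt_1)
  then have "openin circle {0..<1}"
    by (simp add: openin_circle)
  then show ?thesis
    by (meson openin_circle openin_subset openin_topspace subset_antisym)
qed

lemma quotient_map_circle: "quotient_map (top_of_set {0..1}) circle frac"
proof -
  have "y \<in> frac ` {0..1}" if "y \<in> {0..<1}" for y :: real
    using that by (intro image_eqI[of _ _ y]) (auto simp: frac_eq)
  moreover have "frac ` {0..1::real} \<subseteq> {0..<1}"
    by (auto simp: frac_ge_0 frac_lt_1)
  ultimately show ?thesis
    by (auto simp: quotient_map_def topspace_circle openin_circle)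
qed

definition monotone_along_branch :: "complex set \<Rightarrow> (complex \<Rightarrow> real) \<Rightarrow> bool" where
  "monotone_along_branch S \<Phi> \<longleftrightarrow>
     (\<forall>x\<in>S. \<forall>y\<in>S. norm x \<le> norm y \<longrightarrow> \<Phi> x \<le> \<Phi> y) \<or>
     (\<forall>x\<in>S. \<forall>y\<in>S. norm x \<le> norm y \<longrightarrow> \<Phi> y \<le> \<Phi> x)"

end

theory Submission
  imports Defs
begin

text \<open>
  The circle map is the fractional part of a continuous extension \<open>\<Psi>\<close> to the triod of the code \<open>\<psi>\<close>.  Along the
  orbit \<open>\<psi> (f x)\<close> and \<open>\<psi> x + p/q\<close> differ by an integer, so \<open>frac \<circ> \<psi>\<close> carries \<open>f\<close> on \<open>P\<close> to the
  rotation.  Everything else rests on one fact (\<open>code_monotone_on_branches\<close>): for a frontier pattern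
  the code is weakly monotone along every branch, in the same direction on all three.  Then \<open>\<Psi>\<close> can
  be chosen monotone beyond the innermost point of \<open>P\<close> on each branch.  On a coherent strip the integer
  part of \<open>\<Psi>\<close> is constant, so \<open>frac \<circ> \<Psi>\<close> is there a translate of \<open>\<Psi>\<close> and still monotone.

  The code is monotone for the following reason.  Let \<open>y\<close> lie between \<open>0\<close> and \<open>x\<close> on a branch, with
  \<open>f\<^sup>m y = x\<close>.  Since \<open>x\<close> is farther out than \<open>y\<close>, the graph of the cycle has an arrow from \<open>x\<close> to
  \<open>f y\<close>, so the orbit segment from \<open>y\<close> to \<open>x\<close> closes up to the loop \<open>x \<rightarrow> f y \<rightarrow> \<dots> \<rightarrow> x\<close> of length \<open>m\<close>
  with the displacement \<open>d\<close> of that segment (\<open>loop_of_closer_point\<close>).  As \<open>x\<close> and \<open>y\<close> share a branch,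
  \<open>d\<close> is an integer, whence \<open>\<psi> x - \<psi> y = m (\<rho> - d/m)\<close>.  If \<open>\<rho>\<close> is an end-point of the rotation
  interval, then \<open>\<rho> - d/m\<close> has the same weak sign for every loop.

  Two points need work before this argument applies.  First, integrality of \<open>d\<close> needs a canonical
  labelling (\<open>regular_imp_canonical\<close>).  Send a branch met by \<open>P\<close> to the branch containing the image of
  its point of \<open>P\<close> closest to \<open>0\<close>.  A fixed branch would produce a fixed point other than \<open>0\<close>, and two
  exchanged branches would force a primitive 2-cycle, contrary to regularity; hence the three
  branches are permuted cyclically.  Second, the frontier condition speaks of some cycle exhibiting the
  pattern.  An equivalence of cycles fixes \<open>0\<close> and is increasing on each branch
  (\<open>cycle_equiv_imp_iso\<close>), so labels, displacements and rotation numbers are the same for both cycles,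
  and the loop can be formed in the other cycle.
\<close>

section \<open>The branches of the triod\<close>

definition ray :: "complex \<Rightarrow> complex set" where
  "ray e = (\<lambda>t. of_real t * e) ` {0<..1}"

text \<open>Coordinate on the branch in the direction \<open>e\<close>: on the triod this is the retraction onto that branch,
  followed by the distance to \<open>0\<close>. The formula works because distinct cube roots of unity have inner
  product \<open>-1/2\<close>, so that the other two branches are sent to \<open>0\<close>. Being continuous on the whole plane, it
  reduces connectedness arguments on the triod to the intermediate value theorem.\<close>

definition along :: "complex \<Rightarrow> complex \<Rightarrow> real" where
  "along e z = max 0 (Re (z * cnj e))"

lemma norm_cube_root:
  fixes e :: complex
  assumes "e ^ 3 = 1"
  shows "norm e = 1"
proof -
  have "norm e ^ 3 = 1" using assms by (metis norm_one norm_power)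
  then show ?thesis
    using power_eq_imp_eq_base[of "norm e" 3 1] by simp
qed

text \<open>The quotient \<open>w\<close> of two distinct cube roots satisfies \<open>w\<^sup>2 + w + 1 = 0\<close>; multiplication by the
  conjugate of \<open>w\<close> turns this into \<open>2 Re w = -1\<close>.\<close>

lemma Re_cube_roots:
  fixes e e' :: complex
  assumes "e ^ 3 = 1" "e' ^ 3 = 1" "e \<noteq> e'"
  shows "Re (e' * cnj e) = - (1/2)"
proof -
  define w where "w = e' * cnj e"
  have ne: "e * cnj e = 1"
    using norm_cube_root[OF assms(1)] complex_norm_square[of e] by simp
  have nw: "w * cnj w = 1"
    using norm_cube_root[OF assms(1)] norm_cube_root[OF assms(2)] complex_norm_square[of w]
    by (simp add: w_def norm_mult del: complex_cnj_mult)
  have "w ^ 3 = 1"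
    using assms by (simp add: w_def power_mult_distrib flip: complex_cnj_power)
  moreover have "w \<noteq> 1"
  proof
    assume "w = 1"
    then have "e * w = e" by simp
    then have "e' * (e * cnj e) = e" by (simp add: w_def algebra_simps)
    then show False using ne assms(3) by simp
  qed
  moreover have "w ^ 3 - 1 = (w - 1) * (w ^ 2 + w + 1)"
    by (simp add: algebra_simps power2_eq_square power3_eq_cube)
  ultimately have "w ^ 2 + w + 1 = 0" by simp
  then have "cnj w * (w ^ 2 + w + 1) = 0" by simp
  then have "w * (w * cnj w) + (w * cnj w) + cnj w = 0"
    by (simp add: algebra_simps power2_eq_square)
  then have "w + 1 + cnj w = 0" using nw by simp
  then have "Re (w + 1 + cnj w) = 0" by simp
  then have "Re w = - (1/2)" by simp
  then show ?thesis by (simp only: w_def)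
qed

lemma along_scaled:
  assumes "e ^ 3 = 1" "0 \<le> t"
  shows "along e (of_real t * e) = t"
proof -
  have "e * cnj e = 1"
    using norm_cube_root[OF assms(1)] complex_norm_square[of e] by simp
  then have "of_real t * e * cnj e = of_real t" by (simp add: mult.assoc)
  then show ?thesis using assms(2) by (simp only: along_def) simp
qed

lemma along_ray: "e ^ 3 = 1 \<Longrightarrow> z \<in> ray e \<Longrightarrow> along e z = norm z"
  by (auto simp: ray_def along_scaled norm_mult norm_cube_root)

lemma Re_other_ray:
  assumes "e ^ 3 = 1" "e' ^ 3 = 1" "e \<noteq> e'" "z \<in> ray e'"
  shows "Re (z * cnj e) < 0"
proof -
  from assms(4) obtain t where "t > 0" "z = of_real t * e'" by (auto simp: ray_def)
  then have "Re (z * cnj e) = t * Re (e' * cnj e)"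
    by (simp add: mult.assoc)
  then show ?thesis using Re_cube_roots[OF assms(1-3)] \<open>t > 0\<close> by simp
qed

lemma along_other_ray:
  "e ^ 3 = 1 \<Longrightarrow> e' ^ 3 = 1 \<Longrightarrow> e \<noteq> e' \<Longrightarrow> z \<in> ray e' \<Longrightarrow> along e z = 0"
  using Re_other_ray by (fastforce simp: along_def)

lemma along_zero [simp]: "along e 0 = 0"
  by (simp add: along_def)

lemma along_nonneg: "0 \<le> along e z"
  by (simp add: along_def)

lemma continuous_on_along:
  "continuous_on S f \<Longrightarrow> continuous_on S (\<lambda>x. along e (f x))"
  unfolding along_def by (intro continuous_intros)

lemma norm_ray: "e ^ 3 = 1 \<Longrightarrow> z \<in> ray e \<Longrightarrow> 0 < norm z \<and> norm z \<le> 1"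
  by (auto simp: ray_def norm_mult norm_cube_root)

lemma ray_eq_norm: "e ^ 3 = 1 \<Longrightarrow> z \<in> ray e \<Longrightarrow> z = of_real (norm z) * e"
  by (auto simp: ray_def norm_mult norm_cube_root)

lemma rayI: "0 < t \<Longrightarrow> t \<le> 1 \<Longrightarrow> of_real t * e \<in> ray e"
  by (auto simp: ray_def)

lemma triod_iff_ray: "z \<in> triod \<longleftrightarrow> z = 0 \<or> (\<exists>e. e ^ 3 = 1 \<and> z \<in> ray e)"
proof
  assume "z \<in> triod"
  then obtain r where r: "0 \<le> r" "r \<le> 1" "z ^ 3 = of_real r" by (auto simp: triod_def)
  have nr: "norm z ^ 3 = r" using r by (metis abs_of_nonneg norm_of_real norm_power)
  show "z = 0 \<or> (\<exists>e. e ^ 3 = 1 \<and> z \<in> ray e)"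
  proof (cases "z = 0")
    case False
    define e where "e = z / of_real (norm z)"
    have "norm z \<le> 1"
      using nr r(2) by (metis norm_ge_zero one_le_power not_le power_one_over less_imp_le
          one_less_power zero_less_numeral)
    then have "z \<in> ray e"
      using rayI[of "norm z" e] False by (simp add: e_def)
    moreover have "e ^ 3 = 1"
      using nr r False by (auto simp: e_def power_divide simp flip: of_real_power)
    ultimately show ?thesis by blast
  qed auto
next
  assume "z = 0 \<or> (\<exists>e. e ^ 3 = 1 \<and> z \<in> ray e)"
  then show "z \<in> triod"
  proof
    assume "\<exists>e. e ^ 3 = 1 \<and> z \<in> ray e"
    then obtain e t where "e ^ 3 = 1" "0 < t" "t \<le> 1" "z = of_real t * e"
      by (auto simp: ray_def)
    then have "z ^ 3 = of_real (t ^ 3)" "t ^ 3 \<in> {0..1}"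
      by (auto simp: power_mult_distrib power_le_one)
    then show ?thesis unfolding triod_def by blast
  qed (auto simp: triod_def intro!: bexI[of _ 0])
qed

lemma ray_subset_triod: "e ^ 3 = 1 \<Longrightarrow> ray e \<subseteq> triod - {0}"
  using norm_ray triod_iff_ray by fastforce

lemma along_pos_triod:
  assumes "e ^ 3 = 1" "z \<in> triod" "along e z > 0"
  shows "z \<in> ray e" "z = of_real (along e z) * e"
proof -
  show "z \<in> ray e"
    using assms along_other_ray triod_iff_ray by (metis along_zero less_irrefl)
  then show "z = of_real (along e z) * e"
    using assms(1) along_ray ray_eq_norm by metis
qed

lemma along_le_one: "e ^ 3 = 1 \<Longrightarrow> z \<in> triod \<Longrightarrow> along e z \<le> 1"
  by (metis along_pos_triod(1) along_ray norm_ray not_le less_imp_le zero_less_one order_trans)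

lemma connected_ray: "connected (ray e)"
  unfolding ray_def by (intro connected_continuous_image continuous_intros) auto

text \<open>The function \<open>Re (z * cnj e)\<close> is positive on \<open>ray e\<close>, negative on the other two rays, and vanishes
  nowhere on the punctured triod, so no connected set can join \<open>ray e\<close> to another ray.\<close>

lemma connected_component_triod:
  assumes "e ^ 3 = 1" "x \<in> ray e"
  shows "connected_component_set (triod - {0}) x = ray e"
proof
  show "ray e \<subseteq> connected_component_set (triod - {0}) x"
    using assms by (intro connected_component_maximal connected_ray ray_subset_triod)
  show "connected_component_set (triod - {0}) x \<subseteq> ray e"
  proof
    fix y assume y: "y \<in> connected_component_set (triod - {0}) x"
    let ?C = "connected_component_set (triod - {0}) x" and ?g = "\<lambda>z. Re (z * cnj e)"
    show "y \<in> ray e"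
    proof (rule ccontr)
      assume "y \<notin> ray e"
      have sub: "?C \<subseteq> triod - {0}" by (rule connected_component_subset)
      have x: "x \<in> ?C" using assms ray_subset_triod by (auto simp: connected_component_refl)
      have "?g x > 0"
        using along_ray[OF assms] norm_ray[OF assms] unfolding along_def by linarith
      moreover have "?g y < 0"
      proof -
        obtain e' where e': "e' ^ 3 = 1" "y \<in> ray e'" using y sub triod_iff_ray by blast
        then have "e \<noteq> e'" using \<open>y \<notin> ray e\<close> by auto
        then show ?thesis using Re_other_ray[OF assms(1) e'(1)] e'(2) by simp
      qed
      moreover have "connected (?g ` ?C)"
        by (intro connected_continuous_image continuous_intros) simp
      ultimately have "0 \<in> ?g ` ?C"
        using x y connectedD_interval[of "?g ` ?C" "?g y" "?g x" 0] by fastforce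
      then obtain z where z: "z \<in> ?C" "?g z = 0" by auto
      then obtain e' where e': "e' ^ 3 = 1" "z \<in> ray e'" using sub triod_iff_ray by blast
      show False
      proof (cases "e' = e")
        case True
        then show False using e' z along_ray[of e z] norm_ray[of e z]
          by (auto simp add: along_def simp del: times_complex.sel)
      next
        case False
        then show False using Re_other_ray[OF assms(1) e'(1) _ e'(2)] z by simp
      qed
    qed
  qed
qed

lemma branches_eq_rays: "branches = ray ` {e. e ^ 3 = 1}"
proof -
  have "branches = connected_component_set (triod - {0}) ` (triod - {0})"
    by (auto simp: branches_def components_def)
  also have "\<dots> = ray ` {e. e ^ 3 = 1}"
  proof (intro equalityI subsetI)
    fix B assume "B \<in> connected_component_set (triod - {0}) ` (triod - {0})"
    then show "B \<in> ray ` {e. e ^ 3 = 1}"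
      using triod_iff_ray connected_component_triod by fastforce
  next
    fix B assume "B \<in> ray ` {e. e ^ 3 = 1}"
    then obtain e where e: "e ^ 3 = 1" "B = ray e" by auto
    have "of_real 1 * e \<in> ray e" by (rule rayI) auto
    then show "B \<in> connected_component_set (triod - {0}) ` (triod - {0})"
      using e ray_subset_triod[OF e(1)] connected_component_triod[OF e(1)]
      by (intro image_eqI[of _ _ "of_real 1 * e"]) auto
  qed
  finally show ?thesis .
qed

lemma ray_disjoint:
  assumes "e ^ 3 = 1" "e' ^ 3 = 1" "z \<in> ray e" "z \<in> ray e'"
  shows "e = e'"
  using along_ray along_other_ray norm_ray assms by (metis less_irrefl)

lemma branch_unique: "B \<in> branches \<Longrightarrow> B' \<in> branches \<Longrightarrow> z \<in> B \<Longrightarrow> z \<in> B' \<Longrightarrow> B = B'"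
  using ray_disjoint by (auto simp: branches_eq_rays)

lemma triod_branch: "z \<in> triod \<Longrightarrow> z \<noteq> 0 \<Longrightarrow> \<exists>B\<in>branches. z \<in> B"
  by (auto simp: branches_eq_rays triod_iff_ray)

lemma zero_notin_branch: "B \<in> branches \<Longrightarrow> 0 \<notin> B"
  using ray_subset_triod by (auto simp: branches_eq_rays)

lemma card_branches: "card branches = 3"
proof -
  have "inj_on ray {e. e ^ 3 = 1}"
  proof (rule inj_onI)
    fix e e' :: complex assume "e \<in> {e. e ^ 3 = 1}" "e' \<in> {e. e ^ 3 = 1}" "ray e = ray e'"
    then show "e = e'" using ray_disjoint[of e e' "of_real 1 * e"] rayI[of 1 e] by simp
  qed
  then show ?thesis
    by (simp add: branches_eq_rays card_image card_roots_unity_eq)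
qed

lemma branch_eq_if_norm_eq:
  "B \<in> branches \<Longrightarrow> x \<in> B \<Longrightarrow> y \<in> B \<Longrightarrow> norm x = norm y \<Longrightarrow> x = y"
  by (auto simp: branches_eq_rays) (metis ray_eq_norm)

section \<open>Convex hulls\<close>

lemma closed_connected_segment:
  "closed ((\<lambda>t. of_real t * e :: complex) ` {a..b::real})"
  "connected ((\<lambda>t. of_real t * e :: complex) ` {a..b::real})"
  by (intro compact_imp_closed compact_continuous_image connected_continuous_image
      continuous_intros | simp)+

lemma segment_subset_triod:
  assumes "e ^ 3 = 1" "0 \<le> a" "b \<le> 1"
  shows "(\<lambda>t. of_real t * e) ` {a..b} \<subseteq> triod"
proof clarify
  fix t assume "t \<in> {a..b}"
  then show "of_real t * e \<in> triod"
    using assms rayI[of t e] by (cases "t = 0") (auto simp: triod_iff_ray)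
qed

lemma closed_connected_triod: "closed triod" "connected triod"
proof -
  let ?S = "\<lambda>e. (\<lambda>t. of_real t * e :: complex) ` {0..1::real}"
  have eq: "triod = (\<Union>e\<in>{e. e ^ 3 = 1}. ?S e)"
  proof (intro equalityI subsetI)
    fix z assume "z \<in> triod"
    moreover have "0 \<in> ?S 1" by force
    moreover have "(1::complex) ^ 3 = 1" by simp
    ultimately show "z \<in> (\<Union>e\<in>{e. e ^ 3 = 1}. ?S e)"
      unfolding triod_iff_ray ray_def by fastforce
  qed (use segment_subset_triod[where a = 0 and b = 1] in blast)
  show "closed triod"
    unfolding eq by (intro closed_UN ballI closed_connected_segment finite_roots_unity) simp
  have "0 \<in> ?S e" for e by force
  then have "(\<Inter>e\<in>{e. e ^ 3 = 1}. ?S e) \<noteq> {}" by blast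
  then show "connected triod"
    unfolding eq using closed_connected_segment(2) by (intro connected_Union) blast+
qed

lemma triod_hull_subset_triod: "A \<subseteq> triod \<Longrightarrow> triod_hull A \<subseteq> triod"
  unfolding triod_hull_def by (rule hull_minimal) (auto simp: closed_connected_triod)

lemma triod_hull_inc: "A \<subseteq> triod_hull A"
  unfolding triod_hull_def by (rule hull_subset)

text \<open>A connected subset of the triod avoiding \<open>0\<close> lies in a single branch.\<close>

lemma zero_in_triod_hull:
  assumes "x \<in> A" "y \<in> A" "x \<in> B" "y \<in> B'" "B \<in> branches" "B' \<in> branches" "B \<noteq> B'"
  shows "0 \<in> triod_hull A"
  unfolding triod_hull_def hull_def
proof (safe, rule ccontr)
  fix C assume C: "A \<subseteq> C" "C \<subseteq> triod" "connected C" "0 \<notin> C"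
  have "x \<in> C" using C assms by auto
  then have "connected_component_set (triod - {0}) x \<supseteq> C"
    using C by (intro connected_component_maximal) auto
  moreover have "connected_component_set (triod - {0}) x = B"
    using connected_component_triod assms by (auto simp: branches_eq_rays)
  ultimately have "y \<in> B" using C assms by auto
  then show False using branch_unique assms by blast
qed

text \<open>A connected set containing \<open>0\<close> and \<open>x\<close> takes every value between \<open>0\<close> and \<open>norm x\<close> under \<open>along e\<close>, and on
  the triod a positive value of \<open>along e\<close> determines the point.\<close>

lemma segment_in_triod_hull:
  assumes "e ^ 3 = 1" "0 \<in> triod_hull A" "x \<in> A" "x \<in> ray e" "0 \<le> t" "t \<le> norm x"
  shows "of_real t * e \<in> triod_hull A"
  unfolding triod_hull_def hull_def
proof safe
  fix C assume C: "A \<subseteq> C" "C \<subseteq> triod" "connected C" "closed C"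
  have 0: "0 \<in> C" using assms(2) C by (auto simp: triod_hull_def hull_def)
  have "connected (along e ` C)"
    by (intro connected_continuous_image continuous_on_along continuous_on_id C)
  moreover have "along e 0 \<in> along e ` C" "along e x \<in> along e ` C" using 0 C assms by blast+
  ultimately have "t \<in> along e ` C"
    using connectedD_interval assms(5,6) by (metis along_ray along_zero assms(1,4))
  then obtain c where c: "c \<in> C" "t = along e c" by auto
  show "of_real t * e \<in> C"
  proof (cases "t = 0")
    case False
    then show ?thesis using along_pos_triod(2)[OF assms(1), of c] c C assms(5) by auto
  qed (use 0 in simp)
qed

lemma triod_hull_ray:
  assumes "e ^ 3 = 1" "A \<subseteq> ray e" "\<And>x. x \<in> A \<Longrightarrow> a \<le> norm x \<and> norm x \<le> b" "0 < a" "b \<le> 1"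
  shows "triod_hull A \<subseteq> {z \<in> ray e. a \<le> norm z \<and> norm z \<le> b}"
proof -
  have "triod_hull A \<subseteq> (\<lambda>t. of_real t * e) ` {a..b}"
    unfolding triod_hull_def
  proof (rule hull_minimal)
    show "A \<subseteq> (\<lambda>t. of_real t * e) ` {a..b}"
      using assms ray_eq_norm[OF assms(1)] by force
  qed (use closed_connected_segment segment_subset_triod assms in auto)
  also have "\<dots> \<subseteq> {z \<in> ray e. a \<le> norm z \<and> norm z \<le> b}"
    using assms by (auto simp: norm_mult norm_cube_root intro!: rayI)
  finally show ?thesis .
qed

section \<open>Cycles and their equivalence\<close>

lemma cycle_subset: "is_cycle F P \<Longrightarrow> P \<subseteq> triod - {0}"
  by (simp add: is_cycle_def)

text \<open>The cardinality of a cycle is its least period, whichever point the orbit starts from.\<close>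

lemma cycle_orbit:
  assumes "is_cycle F P" "x \<in> P"
  shows "bij_betw (\<lambda>i. (F ^^ i) x) {..<card P} P" "(F ^^ card P) x = x" "card P > 0"
    "range (\<lambda>i. (F ^^ i) x) = P"
proof -
  from assms(1) obtain x0 n where n: "n > 0" "(F ^^ n) x0 = x0" "P = range (\<lambda>k. (F ^^ k) x0)"
    by (auto simp: is_cycle_def)
  from assms(2) n obtain j where j: "x = (F ^^ j) x0" by auto
  have per: "(F ^^ n) x = x"
    using n(2) by (metis j add.commute comp_apply funpow_add)
  show range: "range (\<lambda>i. (F ^^ i) x) = P"
  proof (intro equalityI subsetI)
    fix y assume "y \<in> P"
    then obtain k where k: "y = (F ^^ k) x0" using n by auto
    have "j \<le> n * j" using n(1) by simp
    then have "k + (n * j - j) + j = k + n * j" by (simp only: add.assoc le_add_diff_inverse2)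
    then have "(F ^^ (k + (n * j - j))) x = (F ^^ (k + n * j)) x0"
      unfolding j by (metis comp_apply funpow_add)
    also have "\<dots> = y"
      unfolding k using funpow_mod_eq[OF n(2)] by (metis mod_mult_self2)
    finally show "y \<in> range (\<lambda>i. (F ^^ i) x)" by blast
  next
    fix y assume "y \<in> range (\<lambda>i. (F ^^ i) x)"
    then obtain i where "y = (F ^^ i) x" by blast
    then have "y = (F ^^ (i + j)) x0" by (simp add: j funpow_add)
    then show "y \<in> P" using n by blast
  qed
  define m where "m = (LEAST m. 0 < m \<and> (F ^^ m) x = x)"
  have m: "0 < m" "(F ^^ m) x = x"
    using LeastI[of "\<lambda>m. 0 < m \<and> (F ^^ m) x = x" n] n(1) per by (auto simp: m_def)
  have least: "(F ^^ i) x \<noteq> x" if "0 < i" "i < m" for i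
    using that not_less_Least[of i "\<lambda>m. 0 < m \<and> (F ^^ m) x = x"] by (auto simp: m_def)
  have ne: "(F ^^ i) x \<noteq> (F ^^ j) x" if "i < j" "j < m" for i j
  proof
    assume "(F ^^ i) x = (F ^^ j) x"
    then have "(F ^^ (m - j)) ((F ^^ i) x) = (F ^^ (m - j)) ((F ^^ j) x)" by simp
    then have "(F ^^ (m - j + i)) x = (F ^^ (m - j + j)) x"
      by (simp only: funpow_add comp_apply)
    moreover have "m - j + j = m" "0 < m - j + i" "m - j + i < m" using that by linarith+
    ultimately show False using least[of "m - j + i"] m(2) by simp
  qed
  have inj: "inj_on (\<lambda>i. (F ^^ i) x) {..<m}"
    by (rule linorder_inj_onI) (use ne in auto)
  have "(\<lambda>i. (F ^^ i) x) ` {..<m} = P"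
  proof -
    have "(F ^^ i) x \<in> (\<lambda>i. (F ^^ i) x) ` {..<m}" for i
      using funpow_mod_eq[OF m(2), of i] m(1) by (intro image_eqI[of _ _ "i mod m"]) auto
    then show ?thesis unfolding range[symmetric] by auto
  qed
  then have bij: "bij_betw (\<lambda>i. (F ^^ i) x) {..<m} P" using inj by (simp add: bij_betw_def)
  then have "card P = m" using bij_betw_same_card by fastforce
  then show "bij_betw (\<lambda>i. (F ^^ i) x) {..<card P} P" "(F ^^ card P) x = x" "card P > 0"
    using bij m by auto
qed

lemma cycle_finite: "is_cycle F P \<Longrightarrow> finite P"
  using cycle_orbit(3) by (metis card_gt_0_iff finite.emptyI equals0I)

lemma cycle_nonempty: "is_cycle F P \<Longrightarrow> P \<noteq> {}"
  by (auto simp: is_cycle_def)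

lemma cycle_funpow: "is_cycle F P \<Longrightarrow> x \<in> P \<Longrightarrow> (F ^^ i) x \<in> P"
  using cycle_orbit(4) by (metis rangeI)

lemma cycle_image: "is_cycle F P \<Longrightarrow> x \<in> P \<Longrightarrow> F x \<in> P"
  using cycle_funpow[of F P x 1] by simp

lemma pattern_of_self: "is_cycle F P \<Longrightarrow> (F, P) \<in> pattern_of F P"
  unfolding pattern_of_def cycle_equiv_def
  by (auto intro!: exI[of _ id] homeomorphism_ident simp: id_def)

lemma pattern_of_in_patterns: "is_cycle F P \<Longrightarrow> pattern_of F P \<in> patterns"
  unfolding patterns_def pattern_of_def by (intro quotientI) simp

text \<open>The combinatorial content of an equivalence of cycles: what survives of the homeomorphism of the hulls
  when it is restricted to the finite sets \<open>P\<close> and \<open>Q\<close>. Labels, displacements and rotation numbers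
  depend on these data only.\<close>

definition cycle_iso where
  "cycle_iso F P G Q h \<longleftrightarrow> h ` P = Q \<and> inj_on h P \<and> (\<forall>x\<in>P. h (F x) = G (h x)) \<and>
     (\<forall>x\<in>P. \<forall>B\<in>branches. h x \<in> B \<longleftrightarrow> x \<in> B) \<and>
     (\<forall>x\<in>P. \<forall>y\<in>P. same_branch x y \<longrightarrow> (norm (h x) \<le> norm (h y) \<longleftrightarrow> norm x \<le> norm y))"

text \<open>The homeomorphism preserves the branches, so \<open>0\<close> has no image to go to but \<open>0\<close>. It therefore maps
  the segment from \<open>0\<close> to a point of \<open>P\<close> injectively into the closed branch, starting at \<open>0\<close>, and such a map is
  increasing. That \<open>0\<close> lies in the hull is essential: a cycle on one branch would leave room for a
  reversal of the order.\<close>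

lemma cycle_equiv_imp_iso:
  assumes "(G, Q) \<in> pattern_of F P" "0 \<in> triod_hull P"
  shows "\<exists>h. cycle_iso F P G Q h"
proof -
  from assms(1) obtain h h' where cyc: "is_cycle F P" "is_cycle G Q"
    and hom: "homeomorphism (triod_hull P) (triod_hull Q) h h'"
    and br: "\<And>B. B \<in> branches \<Longrightarrow> h ` (triod_hull P \<inter> B) = triod_hull Q \<inter> B"
    and hP: "h ` P = Q" "\<forall>x\<in>P. h (F x) = G (h x)"
    by (auto simp: pattern_of_def cycle_equiv_def)
  have inj: "inj_on h (triod_hull P)" using hom by (metis homeomorphism_def inj_on_inverseI)
  have sub: "triod_hull P \<subseteq> triod" "triod_hull Q \<subseteq> triod" "P \<subseteq> triod_hull P"
    using cyc cycle_subset triod_hull_subset_triod triod_hull_inc by blast+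
  have mem: "h x \<in> B \<longleftrightarrow> x \<in> B" if "x \<in> triod_hull P" "B \<in> branches" for x B
  proof
    assume "h x \<in> B"
    then have "h x \<in> h ` (triod_hull P \<inter> B)"
      using br that hom by (auto simp: homeomorphism_def)
    then show "x \<in> B" using inj that by (auto dest: inj_onD)
  qed (use br that in auto)
  have h0: "h 0 = 0"
  proof (rule ccontr)
    assume "h 0 \<noteq> 0"
    moreover have "h 0 \<in> triod" using hom assms(2) sub by (auto simp: homeomorphism_def)
    ultimately obtain B where "B \<in> branches" "h 0 \<in> B" using triod_branch by blast
    then show False using mem[OF assms(2)] zero_notin_branch by blast
  qed
  have less: "norm (h x) < norm (h y)"
    if P: "x \<in> P" "y \<in> P" and sb: "same_branch x y" and lt: "norm x < norm y" for x y
  proof (rule ccontr)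
    assume "\<not> norm (h x) < norm (h y)"
    obtain e where e: "e ^ 3 = 1" "x \<in> ray e" "y \<in> ray e"
      using sb by (auto simp: same_branch_def branches_eq_rays)
    let ?r = "\<lambda>t. norm (h (of_real t * e))"
    have seg: "of_real t * e \<in> triod_hull P" if "t \<in> {0..norm x}" for t
      using segment_in_triod_hull[OF e(1) assms(2) \<open>x \<in> P\<close> e(2)] that by simp
    have xy: "of_real (norm x) * e = x" using e ray_eq_norm by metis
    have "continuous_on {0..norm x} (\<lambda>t. h (of_real t * e))"
    proof (rule continuous_on_compose2[of "triod_hull P" h])
      show "continuous_on (triod_hull P) h" using hom by (simp add: homeomorphism_def)
      show "continuous_on {0..norm x} (\<lambda>t. of_real t * e)" by (intro continuous_intros)
    qed (use seg in auto)
    then have "continuous_on {0..norm x} ?r" by (rule continuous_on_norm)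
    moreover have "?r 0 \<le> norm (h y)" "norm (h y) \<le> ?r (norm x)"
      using \<open>\<not> norm (h x) < norm (h y)\<close> h0 xy by auto
    ultimately obtain s where s: "0 \<le> s" "s \<le> norm x" "?r s = norm (h y)"
      using IVT'[of ?r 0 "norm (h y)" "norm x"] by auto
    have "h y \<in> ray e" using mem[of y "ray e"] e sub \<open>y \<in> P\<close> by (auto simp: branches_eq_rays)
    have "s \<noteq> 0"
    proof
      assume "s = 0"
      then have "h y = 0" using s(3) h0 by simp
      then show False using \<open>h y \<in> ray e\<close> norm_ray[OF e(1)] by fastforce
    qed
    then have "of_real s * e \<in> ray e"
      using s norm_ray[OF e(1,2)] by (intro rayI) auto
    then have "h (of_real s * e) \<in> ray e"
      using mem[of "of_real s * e" "ray e"] e(1) seg s by (auto simp: branches_eq_rays)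
    then have "h (of_real s * e) = h y"
      using branch_eq_if_norm_eq[of "ray e"] \<open>h y \<in> ray e\<close> s(3) e(1) by (auto simp: branches_eq_rays)
    then have "of_real s * e = y"
      using inj seg s sub P(2) by (auto dest!: inj_onD)
    then have "norm y = s" using s e(1) norm_cube_root[OF e(1)] by (auto simp: norm_mult)
    then show False using s lt by simp
  qed
  have "cycle_iso F P G Q h"
    unfolding cycle_iso_def
  proof (intro conjI ballI impI)
    show "inj_on h P" using inj sub(3) inj_on_subset by blast
    show "h x \<in> B \<longleftrightarrow> x \<in> B" if "x \<in> P" "B \<in> branches" for x B using mem that sub by blast
    fix x y assume "x \<in> P" "y \<in> P" "same_branch x y"
    moreover from this have "same_branch y x" by (auto simp: same_branch_def)
    ultimately show "norm (h x) \<le> norm (h y) \<longleftrightarrow> norm x \<le> norm y"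
      using less[of x y] less[of y x] branch_eq_if_norm_eq
      by (smt (verit) same_branch_def)
  qed (use hP in auto)
  then show ?thesis by blast
qed

section \<open>Canonical labelling of regular cycles\<close>

lemma triod_maps_path:
  assumes "g \<in> triod_maps" "e ^ 3 = 1"
  shows "continuous_on {0..1} (\<lambda>t. g (of_real t * e))" "g 0 = 0"
    "t \<in> {0..1} \<Longrightarrow> g (of_real t * e) \<in> triod"
proof -
  have seg: "of_real t * e \<in> triod" if "t \<in> {0..1}" for t
    using segment_subset_triod[of e 0 1] assms(2) that by blast
  show "continuous_on {0..1} (\<lambda>t. g (of_real t * e))"
  proof (rule continuous_on_compose2[of triod g])
    show "continuous_on triod g" using assms(1) by (simp add: triod_maps_def)
    show "continuous_on {0..1} (\<lambda>t. of_real t * e)" by (intro continuous_intros)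
  qed (use seg in auto)
  show "g 0 = 0" using assms(1) by (auto simp: triod_maps_def triod_iff_ray)
  show "t \<in> {0..1} \<Longrightarrow> g (of_real t * e) \<in> triod"
    using assms(1) seg by (auto simp: triod_maps_def)
qed

text \<open>Pushed out at \<open>u\<close> and unable to leave the triod at the end of the branch, the map has a fixed point in
  between.\<close>

lemma no_expansion_along_branch:
  assumes "g \<in> triod_maps" "e ^ 3 = 1" "u \<in> ray e" "g u \<in> ray e" "norm u \<le> norm (g u)"
  shows False
proof -
  let ?a = "\<lambda>t. along e (g (of_real t * e)) - t"
  note path = triod_maps_path[OF assms(1,2)]
  have u: "of_real (norm u) * e = u" "0 < norm u" "norm u \<le> 1"
    using assms ray_eq_norm norm_ray by metis+
  have "continuous_on {0..1} ?a"
    by (intro continuous_on_diff continuous_on_id continuous_on_along path)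
  then have "continuous_on {norm u..1} ?a" using u by (elim continuous_on_subset) auto
  moreover have "?a 1 \<le> 0" using along_le_one[OF assms(2) path(3)[of 1]] by simp
  moreover have "0 \<le> ?a (norm u)" using u assms along_ray by simp
  ultimately obtain s where s: "norm u \<le> s" "s \<le> 1" "?a s = 0"
    using IVT2'[of ?a 1 0 "norm u"] u by auto
  moreover have "0 < s" using u(2) s(1) by linarith
  ultimately have "g (of_real s * e) = of_real s * e"
    using along_pos_triod(2)[OF assms(2) path(3)[of s]] by simp
  moreover have "of_real s * e \<in> ray e" using s(2) \<open>0 < s\<close> by (intro rayI)
  ultimately show False
    using assms(1) ray_subset_triod[OF assms(2)] by (auto simp: triod_maps_def)
qed

text \<open>Going from \<open>ray e\<close> to \<open>ray e'\<close> and back, read in the branch coordinates, is a map of \<open>[0,1]\<close> to itself. Its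
  fixed point \<open>0\<close> must be avoided: some positive \<open>s0 \<le> norm u\<close> is mapped precisely to the coordinate of \<open>v\<close>, and
  thus on the way back to at least \<open>norm u\<close>, so the composite has a fixed point in \<open>[s0,1]\<close>.\<close>

lemma two_cycle_if_branches_exchanged:
  assumes g: "g \<in> triod_maps" and e: "e ^ 3 = 1" "e' ^ 3 = 1"
    and u: "u \<in> ray e" "g u \<in> ray e'" "norm v \<le> norm (g u)"
    and v: "v \<in> ray e'" "g v \<in> ray e" "norm u \<le> norm (g v)"
  shows "\<exists>z\<in>ray e. g z \<in> ray e' \<and> g (g z) = z"
proof -
  let ?a = "\<lambda>t. along e' (g (of_real t * e))" and ?b = "\<lambda>t. along e (g (of_real t * e'))"
  note path = triod_maps_path[OF g e(1)] and path' = triod_maps_path[OF g e(2)]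
  have nu: "of_real (norm u) * e = u" "0 < norm u" "norm u \<le> 1"
    using e u ray_eq_norm norm_ray by metis+
  have nv: "of_real (norm v) * e' = v" "0 < norm v" "norm v \<le> 1"
    using e v ray_eq_norm norm_ray by metis+
  have ca: "continuous_on {0..1} ?a" and cb: "continuous_on {0..1} ?b"
    by (intro continuous_on_along path path')+
  have a01: "?a t \<in> {0..1}" if "t \<in> {0..1}" for t
    using that along_nonneg along_le_one[OF e(2) path(3)] by auto
  obtain s0 where s0: "0 \<le> s0" "s0 \<le> norm u" "?a s0 = norm v"
    using IVT'[of ?a 0 "norm v" "norm u"] continuous_on_subset[OF ca, of "{0..norm u}"]
      path(2) nu u along_ray e by auto
  have "s0 \<noteq> 0" using s0 nv path(2) by auto
  let ?d = "\<lambda>s. ?b (?a s) - s"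
  have "continuous_on {0..1} (\<lambda>s. ?b (?a s))"
    using a01 by (intro continuous_on_compose2[OF cb ca]) auto
  then have "continuous_on {0..1} ?d" by (intro continuous_on_diff continuous_on_id)
  then have "continuous_on {s0..1} ?d" using s0 by (elim continuous_on_subset) auto
  moreover have "?d 1 \<le> 0" using along_le_one[OF e(1) path'(3)[OF a01[of 1]]] by simp
  moreover have "0 \<le> ?d s0" using s0 nv(1) v along_ray e(1) by simp
  ultimately obtain s where s: "s0 \<le> s" "s \<le> 1" "?b (?a s) = s"
    using IVT2'[of ?d 1 0 s0] s0 nu by auto
  have pos: "s > 0" using s s0 \<open>s0 \<noteq> 0\<close> by simp
  have "?a s \<noteq> 0" using s(3) pos path'(2) by auto
  then have as: "?a s > 0" using along_nonneg[of e' "g (of_real s * e)"] by linarith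
  note gz = along_pos_triod[OF e(2) path(3)[of s] as]
  have "?b (?a s) > 0" using s(3) pos by simp
  from along_pos_triod(2)[OF e(1) path'(3)[OF a01] this] s(3)
  have "g (of_real (?a s) * e') = of_real s * e" using s pos by simp
  then have "g (g (of_real s * e)) = of_real s * e" using gz(2) s pos by simp
  moreover have "of_real s * e \<in> ray e" using s pos by (intro rayI) auto
  moreover have "g (of_real s * e) \<in> ray e'" using gz(1) s pos by simp
  ultimately show ?thesis by blast
qed

lemma two_point_cycle:
  assumes "g \<in> triod_maps" "e ^ 3 = 1" "e' ^ 3 = 1" "e \<noteq> e'"
    and "z \<in> ray e" "g z \<in> ray e'" "g (g z) = z"
  shows "is_cycle g {z, g z}" "primitive_cycle {z, g z}" "card {z, g z} = 2"
proof -
  have ne: "z \<noteq> g z" using ray_disjoint[OF assms(2,3,5)] assms(4,6) by auto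
  then show "card {z, g z} = 2" by simp
  have sub: "{z, g z} \<subseteq> triod - {0}"
    using ray_subset_triod[OF assms(2)] ray_subset_triod[OF assms(3)] assms(5,6) by auto
  have "{z, g z} = range (\<lambda>k. (g ^^ k) z)"
  proof (intro equalityI subsetI)
    fix y assume "y \<in> {z, g z}"
    then have "y = (g ^^ 0) z \<or> y = (g ^^ 1) z" by auto
    then show "y \<in> range (\<lambda>k. (g ^^ k) z)" by blast
  next
    fix y assume "y \<in> range (\<lambda>k. (g ^^ k) z)"
    then obtain k where k: "y = (g ^^ k) z" by auto
    have "(g ^^ k) z \<in> {z, g z}" for k
      by (induction k) (use assms(7) in auto)
    then show "y \<in> {z, g z}" using k by simp
  qed
  moreover have "(g ^^ 2) z = z" using assms(7) by (simp add: numeral_2_eq_2)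
  ultimately show "is_cycle g {z, g z}"
    using assms(1) sub unfolding is_cycle_def
    by (intro conjI exI[of _ z] exI[of _ "2::nat"]) simp_all
  have "\<not> (z \<in> B \<and> g z \<in> B)" if "B \<in> branches" for B
    using that assms ray_disjoint[OF _ assms(2)] ray_disjoint[OF _ assms(3)]
    unfolding branches_eq_rays by blast
  then show "primitive_cycle {z, g z}"
    unfolding primitive_cycle_def same_branch_def by auto
qed

lemma triod_hull_two_branches:
  assumes "e ^ 3 = 1" "e' ^ 3 = 1" "e \<noteq> e'" "z \<in> ray e" "w \<in> ray e'"
  shows "triod_hull {z, w} =
    (\<lambda>t. of_real t * e) ` {0..norm z} \<union> (\<lambda>t. of_real t * e') ` {0..norm w}"
    (is "_ = ?A \<union> ?B")
proof
  have 0: "0 \<in> ?A" "0 \<in> ?B" by (auto intro!: image_eqI[of _ _ 0])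
  show "triod_hull {z, w} \<subseteq> ?A \<union> ?B"
    unfolding triod_hull_def
  proof (rule hull_minimal)
    show "{z, w} \<subseteq> ?A \<union> ?B" 
      using ray_eq_norm[OF assms(1,4)] ray_eq_norm[OF assms(2,5)]
      by (auto intro: image_eqI[of z _ "norm z"] image_eqI[of w _ "norm w"])
    have "connected (?A \<union> ?B)" using 0 by (intro connected_Un closed_connected_segment) auto
    then show "?A \<union> ?B \<subseteq> triod \<and> closed (?A \<union> ?B) \<and> connected (?A \<union> ?B)"
      using assms norm_ray[of e z] norm_ray[of e' w]
      by (intro conjI closed_Un closed_connected_segment Un_least segment_subset_triod) auto
  qed
  have "0 \<in> triod_hull {z, w}"
    using assms ray_disjoint[OF assms(1,2,4)]
    by (intro zero_in_triod_hull[of z _ w "ray e" "ray e'"]) (auto simp: branches_eq_rays)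
  then show "?A \<union> ?B \<subseteq> triod_hull {z, w}"
    using segment_in_triod_hull[of e "{z, w}" z] segment_in_triod_hull[of e' "{z, w}" w] assms
    by auto
qed

lemma along_scaled_other:
  assumes "e ^ 3 = 1" "e' ^ 3 = 1" "e \<noteq> e'" "0 \<le> t" "t \<le> 1"
  shows "along e (of_real t * e') = 0"
  using assms along_other_ray[OF assms(1-3), of "of_real t * e'"] rayI[of t e']
  by (cases "t = 0") auto

text \<open>All primitive 2-cycles on the same two branches exhibit one pattern: rescaling each of the two segments of
  the hull is the required homeomorphism.\<close>

lemma two_point_cycles_equiv:
  assumes cyc: "is_cycle f {z, f z}" "is_cycle g {w, g w}"
    and e: "e ^ 3 = 1" "e' ^ 3 = 1" "e \<noteq> e'"
    and z: "z \<in> ray e" "f z \<in> ray e'" "f (f z) = z"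
    and w: "w \<in> ray e" "g w \<in> ray e'" "g (g w) = w"
  shows "(g, {w, g w}) \<in> pattern_of f {z, f z}"
proof -
  \<comment> \<open>rescales the segment on \<open>ray e\<close> from length \<open>a\<close> to \<open>b\<close> and the one on \<open>ray e'\<close> from \<open>a'\<close> to \<open>b'\<close>;
    interchanging the lengths gives the inverse\<close>
  define H where "H = (\<lambda>a a' b b' c. of_real (along e c * (b / a)) * e
    + of_real (along e' c * (b' / a')) * e' :: complex)"
  define S where "S = (\<lambda>a a'. (\<lambda>t. of_real t * e) ` {0..a} \<union> (\<lambda>t. of_real t * e') ` {0..a'})"
  have He: "H a a' b b' (of_real t * e) = of_real (t * (b / a)) * e" if "0 \<le> t" "t \<le> 1" for a a' b b' t
    using that e along_scaled along_scaled_other[of e' e] by (simp add: H_def)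
  have He': "H a a' b b' (of_real t * e') = of_real (t * (b' / a')) * e'" if "0 \<le> t" "t \<le> 1" for a a' b b' t
    using that e along_scaled along_scaled_other[of e e'] by (simp add: H_def)
  define a a' b b' where "a = norm z" and "a' = norm (f z)" and "b = norm w" and "b' = norm (g w)"
  have pos: "a \<in> {0<..1}" "a' \<in> {0<..1}" "b \<in> {0<..1}" "b' \<in> {0<..1}"
    using norm_ray e z w by (auto simp: a_def a'_def b_def b'_def)
  have scale: "t * (v / u) \<in> {0..v}" if "t \<in> {0..u}" "0 < u" "0 < v" for t u v :: real
    using that by (auto simp: field_simps mult_left_mono)
  have img: "H a a' b b' c \<in> S b b'" "H b b' a a' (H a a' b b' c) = c"
    if "c \<in> S a a'" "a \<in> {0<..1}" "a' \<in> {0<..1}" "b \<in> {0<..1}" "b' \<in> {0<..1}" for a a' b b' c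
  proof -
    have "H a a' b b' c \<in> S b b' \<and> H b b' a a' (H a a' b b' c) = c"
      using that(1)[unfolded S_def Un_iff]
    proof
      assume "c \<in> (\<lambda>t. of_real t * e) ` {0..a}"
      then obtain t where t: "c = of_real t * e" "t \<in> {0..a}" by blast
      have s: "t * (b / a) \<in> {0..b}" by (rule scale[OF t(2)]) (use that in auto)
      then have s1: "0 \<le> t * (b / a)" "t * (b / a) \<le> 1"
        using that(4,5) unfolding atLeastAtMost_iff greaterThanAtMost_iff by linarith+
      have H1: "H a a' b b' c = of_real (t * (b / a)) * e"
        unfolding t(1) by (rule He) (use t(2) that in auto)
      have H2: "H b b' a a' (of_real (t * (b / a)) * e) = of_real (t * (b / a) * (a / b)) * e"
        by (rule He[OF s1])
      have "t * (b / a) * (a / b) = t" using that by simp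
      then have "H b b' a a' (H a a' b b' c) = c" unfolding H1 by (simp only: H2 t(1))
      moreover have "H a a' b b' c \<in> (\<lambda>t. of_real t * e) ` {0..b}"
        unfolding H1 using s by (rule imageI)
      ultimately show ?thesis unfolding S_def by blast
    next
      assume "c \<in> (\<lambda>t. of_real t * e') ` {0..a'}"
      then obtain t where t: "c = of_real t * e'" "t \<in> {0..a'}" by blast
      have s: "t * (b' / a') \<in> {0..b'}" by (rule scale[OF t(2)]) (use that in auto)
      then have s1: "0 \<le> t * (b' / a')" "t * (b' / a') \<le> 1"
        using that(4,5) unfolding atLeastAtMost_iff greaterThanAtMost_iff by linarith+
      have H1: "H a a' b b' c = of_real (t * (b' / a')) * e'"
        unfolding t(1) by (rule He') (use t(2) that in auto)
      have H2: "H b b' a a' (of_real (t * (b' / a')) * e') = of_real (t * (b' / a') * (a' / b')) * e'"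
        by (rule He'[OF s1])
      have "t * (b' / a') * (a' / b') = t" using that by simp
      then have "H b b' a a' (H a a' b b' c) = c" unfolding H1 by (simp only: H2 t(1))
      moreover have "H a a' b b' c \<in> (\<lambda>t. of_real t * e') ` {0..b'}"
        unfolding H1 using s by (rule imageI)
      ultimately show ?thesis unfolding S_def by blast
    qed
    then show "H a a' b b' c \<in> S b b'" "H b b' a a' (H a a' b b' c) = c" by blast+
  qed
  have hull: "triod_hull {z, f z} = S a a'" "triod_hull {w, g w} = S b b'"
    using triod_hull_two_branches e z w by (auto simp: S_def a_def a'_def b_def b'_def)
  have cont: "continuous_on X (H a a' b b')" for X a a' b b'
    unfolding H_def
    by (intro continuous_on_add continuous_on_mult continuous_on_of_real continuous_on_along
        continuous_on_id continuous_on_const)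
  have hom: "homeomorphism (S a a') (S b b') (H a a' b b') (H b b' a a')"
    by (rule homeomorphismI[OF cont cont])
      (use img[OF _ pos] img[OF _ pos(3,4,1,2)] in blast)+
  have branch: "H a a' b b' c \<in> B" if c: "c \<in> S a a'" "c \<in> B" and B: "B \<in> branches"
    and pos: "a \<in> {0<..1}" "a' \<in> {0<..1}" "b \<in> {0<..1}" "b' \<in> {0<..1}" for a a' b b' c B
    using c(1)[unfolded S_def Un_iff]
  proof
    assume "c \<in> (\<lambda>t. of_real t * e) ` {0..a}"
    then obtain t where t: "c = of_real t * e" "t \<in> {0..a}" by blast
    have "t \<noteq> 0" using t c(2) B zero_notin_branch by auto
    then have "c \<in> ray e" using t pos by (auto intro: rayI)
    then have "B = ray e" using branch_unique[of B "ray e"] B c(2) e by (auto simp: branches_eq_rays)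
    moreover have "H a a' b b' c = of_real (t * (b / a)) * e"
      unfolding t(1) by (rule He) (use t(2) pos in auto)
    moreover have "0 < t * (b / a)" using \<open>t \<noteq> 0\<close> t(2) pos by simp
    moreover have "t * (b / a) \<in> {0..b}" by (rule scale[OF t(2)]) (use pos in auto)
    then have "t * (b / a) \<le> 1"
      using pos(3,4) unfolding atLeastAtMost_iff greaterThanAtMost_iff by linarith
    ultimately show ?thesis by (simp only: rayI)
  next
    assume "c \<in> (\<lambda>t. of_real t * e') ` {0..a'}"
    then obtain t where t: "c = of_real t * e'" "t \<in> {0..a'}" by blast
    have "t \<noteq> 0" using t c(2) B zero_notin_branch by auto
    then have "c \<in> ray e'" using t pos by (auto intro: rayI)
    then have "B = ray e'" using branch_unique[of B "ray e'"] B c(2) e by (auto simp: branches_eq_rays)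
    moreover have "H a a' b b' c = of_real (t * (b' / a')) * e'"
      unfolding t(1) by (rule He') (use t(2) pos in auto)
    moreover have "0 < t * (b' / a')" using \<open>t \<noteq> 0\<close> t(2) pos by simp
    moreover have "t * (b' / a') \<in> {0..b'}" by (rule scale[OF t(2)]) (use pos in auto)
    then have "t * (b' / a') \<le> 1"
      using pos(3,4) unfolding atLeastAtMost_iff greaterThanAtMost_iff by linarith
    ultimately show ?thesis by (simp only: rayI)
  qed
  have br: "H a a' b b' ` (S a a' \<inter> B) = S b b' \<inter> B" if "B \<in> branches" for B
  proof (intro equalityI subsetI)
    fix c assume "c \<in> H a a' b b' ` (S a a' \<inter> B)"
    then show "c \<in> S b b' \<inter> B"
      using img(1)[OF _ pos] branch[OF _ _ that pos] by blast
  next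
    fix c assume c: "c \<in> S b b' \<inter> B"
    then have "H b b' a a' c \<in> S a a' \<inter> B"
      using img(1)[OF _ pos(3,4,1,2)] branch[OF _ _ that pos(3,4,1,2)] by blast
    moreover have "c = H a a' b b' (H b b' a a' c)"
      using img(2)[OF _ pos(3,4,1,2), of c] c by simp
    ultimately show "c \<in> H a a' b b' ` (S a a' \<inter> B)" by blast
  qed
  have "z = of_real a * e" "f z = of_real a' * e'" "w = of_real b * e" "g w = of_real b' * e'"
    unfolding a_def a'_def b_def b'_def using ray_eq_norm e z w by metis+
  then have "H a a' b b' z = w" "H a a' b b' (f z) = g w"
    using He[of a a a' b b'] He'[of a' a a' b b'] pos by auto
  then have "H a a' b b' ` {z, f z} = {w, g w}" "\<forall>x\<in>{z, f z}. H a a' b b' (f x) = g (H a a' b b' x)"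
    using z(3) w(3) by auto
  then show ?thesis
    using cyc hom br unfolding pattern_of_def cycle_equiv_def hull[symmetric] by blast
qed

definition closest :: "complex set \<Rightarrow> complex set \<Rightarrow> complex \<Rightarrow> bool" where
  "closest P B p \<longleftrightarrow> p \<in> P \<inter> B \<and> (\<forall>x\<in>P \<inter> B. norm p \<le> norm x)"

lemma ex_closest:
  assumes "finite P" "P \<inter> B \<noteq> {}"
  shows "\<exists>p. closest P B p"
proof -
  have "Min (norm ` (P \<inter> B)) \<in> norm ` (P \<inter> B)" using assms by (intro Min_in) auto
  then obtain p where p: "p \<in> P \<inter> B" "norm p = Min (norm ` (P \<inter> B))" by auto
  then have "\<forall>x\<in>P \<inter> B. norm p \<le> norm x" using assms(1) by auto
  then show ?thesis using p(1) unfolding closest_def by blast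
qed

lemma canonical_labelling_iff_closest:
  "canonical_labelling F P b \<longleftrightarrow> bij_betw b {..<3} branches \<and>
     (\<forall>i<3. \<exists>p. closest P (b i) p \<and> F p \<in> b (Suc i mod 3))"
  unfolding canonical_labelling_def closest_def by blast

text \<open>The exchange of the two branches by the closest points is inherited by every cycle of the pattern, so each
  map having such a cycle has a primitive 2-cycle on these branches. All those 2-cycles have the same pattern,
  which is therefore forced.\<close>

lemma exchange_imp_not_regular:
  assumes P: "is_cycle F P" and B: "B \<in> branches" "B' \<in> branches" "B \<noteq> B'"
    and u: "closest P B u" "F u \<in> B'" and v: "closest P B' v" "F v \<in> B"
  shows "\<not> regular_pattern (pattern_of F P)"
proof -
  obtain e e' where e: "e ^ 3 = 1" "e' ^ 3 = 1" "B = ray e" "B' = ray e'" "e \<noteq> e'"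
    using B by (auto simp: branches_eq_rays)
  have uv: "u \<in> P" "v \<in> P" "u \<in> B" "v \<in> B'" using u v by (auto simp: closest_def)
  have le: "norm v \<le> norm (F u)" "norm u \<le> norm (F v)"
    using u v cycle_image[OF P] uv by (auto simp: closest_def)
  have zero: "0 \<in> triod_hull P" using zero_in_triod_hull uv B by blast
  have ex: "\<exists>z\<in>ray e. g z \<in> ray e' \<and> g (g z) = z"
    if g: "g \<in> triod_maps" and Q: "(g, Q) \<in> pattern_of F P" for g Q
  proof -
    obtain h where h: "cycle_iso F P g Q h" using cycle_equiv_imp_iso Q zero by blast
    have mem: "h x \<in> C \<longleftrightarrow> x \<in> C" if "x \<in> P" "C \<in> branches" for x C
      using h that by (auto simp: cycle_iso_def)
    have ord: "norm (h x) \<le> norm (h y)" if "x \<in> P" "y \<in> P" "C \<in> branches" "x \<in> C" "y \<in> C" "norm x \<le> norm y" for x y C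
      using h that unfolding cycle_iso_def same_branch_def by blast
    have com: "g (h x) = h (F x)" if "x \<in> P" for x using h that by (auto simp: cycle_iso_def)
    have Fuv: "F u \<in> P" "F v \<in> P" using uv cycle_image[OF P] by auto
    show ?thesis
    proof (rule two_cycle_if_branches_exchanged[OF g e(1,2), of "h u" "h v"])
      show "h u \<in> ray e" "g (h u) \<in> ray e'" "h v \<in> ray e'" "g (h v) \<in> ray e"
        using mem com uv Fuv u v B e(3,4) by auto
      show "norm (h v) \<le> norm (g (h u))" "norm (h u) \<le> norm (g (h v))"
        using ord[of v "F u" B'] ord[of u "F v" B] com uv Fuv u v B le by auto
    qed
  qed
  have F: "F \<in> triod_maps" using P by (simp add: is_cycle_def)
  obtain z where z: "z \<in> ray e" "F z \<in> ray e'" "F (F z) = z"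
    using ex[OF F pattern_of_self[OF P]] by blast
  note two = two_point_cycle[OF _ e(1,2,5)]
  let ?B = "pattern_of F {z, F z}"
  have "forces (pattern_of F P) ?B"
    unfolding forces_def
  proof (intro ballI impI)
    fix g assume g: "g \<in> triod_maps" "\<exists>Q. (g, Q) \<in> pattern_of F P"
    then obtain w where w: "w \<in> ray e" "g w \<in> ray e'" "g (g w) = w" using ex by blast
    have "(g, {w, g w}) \<in> ?B"
      by (rule two_point_cycles_equiv[OF two(1)[OF F z] two(1)[OF g(1) w] e(1,2,5) z w])
    then show "\<exists>Q. (g, Q) \<in> ?B" ..
  qed
  moreover have "?B \<in> patterns" "(F, {z, F z}) \<in> ?B"
    using two(1)[OF F z] by (auto intro: pattern_of_in_patterns pattern_of_self)
  ultimately show ?thesis using two(2,3)[OF F z] unfolding regular_pattern_def by blast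
qed

text \<open>A map without fixed points and without 2-cycles from a nonempty subset of a set of three elements to itself
  is a cyclic permutation of all three.\<close>

lemma regular_imp_canonical:
  assumes P: "is_cycle F P" and reg: "regular_pattern (pattern_of F P)"
  shows "\<exists>b. canonical_labelling F P b"
proof -
  have fin: "finite P" by (rule cycle_finite[OF P])
  define occ where "occ = {B \<in> branches. P \<inter> B \<noteq> {}}"
  have "\<exists>B'\<in>occ. B' \<noteq> B \<and> (\<exists>p. closest P B p \<and> F p \<in> B')" if B: "B \<in> occ" for B
  proof -
    obtain p where p: "closest P B p" using ex_closest fin B unfolding occ_def by blast
    then have Fp: "F p \<in> P" using cycle_image[OF P] by (auto simp: closest_def)
    then obtain B' where B': "B' \<in> branches" "F p \<in> B'"
      using triod_branch cycle_subset[OF P] by blast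
    have "B' \<noteq> B"
    proof
      assume "B' = B"
      obtain e where e: "e ^ 3 = 1" "B = ray e" using B by (auto simp: occ_def branches_eq_rays)
      show False
        using no_expansion_along_branch[of F e p] P e p Fp B' \<open>B' = B\<close>
        by (auto simp: is_cycle_def closest_def)
    qed
    then show ?thesis using B' Fp p unfolding occ_def by blast
  qed
  then obtain \<tau> where \<tau>: "\<And>B. B \<in> occ \<Longrightarrow> \<tau> B \<in> occ" "\<And>B. B \<in> occ \<Longrightarrow> \<tau> B \<noteq> B"
      "\<And>B. B \<in> occ \<Longrightarrow> \<exists>p. closest P B p \<and> F p \<in> \<tau> B" by metis
  have no2: "\<tau> (\<tau> B) \<noteq> B" if B: "B \<in> occ" for B
  proof
    assume "\<tau> (\<tau> B) = B"
    obtain u where u: "closest P B u" "F u \<in> \<tau> B" using \<tau>(3)[OF B] by blast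
    obtain v where v: "closest P (\<tau> B) v" "F v \<in> B" using \<tau>(3)[OF \<tau>(1)[OF B]] \<open>\<tau> (\<tau> B) = B\<close> by auto
    show False
      using exchange_imp_not_regular[OF P _ _ _ u v] reg \<tau>(1,2)[OF B] B by (auto simp: occ_def)
  qed
  obtain x where "x \<in> P" using cycle_nonempty[OF P] by blast
  then obtain B0 where B0: "B0 \<in> occ"
    using triod_branch cycle_subset[OF P] unfolding occ_def by blast
  define B1 B2 where "B1 = \<tau> B0" and "B2 = \<tau> B1"
  have B1: "B1 \<in> occ" and B2: "B2 \<in> occ" and t2: "\<tau> B2 \<in> occ"
    using B0 \<tau>(1) by (auto simp: B1_def B2_def)
  have dist: "B0 \<noteq> B1" "B1 \<noteq> B2" "B0 \<noteq> B2" "\<tau> B2 \<noteq> B1" "\<tau> B2 \<noteq> B2"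
    using \<tau>(2) no2 B0 B1 B2 by (auto simp: B1_def B2_def)
  have all: "{B0, B1, B2} = branches"
  proof (rule card_subset_eq)
    show "finite branches" using card_branches by (simp add: card_ge_0_finite)
    show "{B0, B1, B2} \<subseteq> branches" using B0 B1 B2 by (auto simp: occ_def)
    show "card {B0, B1, B2} = card branches" using dist by (simp add: card_branches)
  qed
  have "\<tau> B2 \<in> {B0, B1, B2}" using t2 unfolding all occ_def by simp
  then have closing: "\<tau> B2 = B0" using dist by simp
  define b where "b i = (if i = 0 then B0 else if i = 1 then B1 else B2)" for i :: nat
  have three: "{..<3} = {0, 1, 2::nat}" by auto
  have "bij_betw b {..<3} branches"
    unfolding bij_betw_def three all[symmetric] using dist by (simp add: b_def insert_commute)
  moreover have "\<exists>p. closest P (b i) p \<and> F p \<in> b (Suc i mod 3)" if "i < 3" for i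
  proof -
    have "i \<in> {0, 1, 2}" using that three by blast
    then have "b i \<in> occ \<and> b (Suc i mod 3) = \<tau> (b i)"
      using B0 B1 B2 closing by (auto simp: b_def B1_def[symmetric] B2_def[symmetric])
    then show ?thesis using \<tau>(3)[of "b i"] by simp
  qed
  ultimately show ?thesis unfolding canonical_labelling_iff_closest by blast
qed

section \<open>Displacements and rotation numbers\<close>

lemma cycle_iso_cong:
  assumes "\<And>x. x \<in> P \<Longrightarrow> f x = F x" "\<And>y. y \<in> Q \<Longrightarrow> g y = G y"
  shows "cycle_iso f P g Q h \<longleftrightarrow> cycle_iso F P G Q h"
  using assms by (auto simp: cycle_iso_def)

lemma closest_iso:
  assumes "cycle_iso F P G Q h" "B \<in> branches" "p \<in> P"
  shows "closest Q B (h p) \<longleftrightarrow> closest P B p"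
proof -
  have mem: "h x \<in> B \<longleftrightarrow> x \<in> B" if "x \<in> P" for x
    using assms that by (auto simp: cycle_iso_def)
  have ord: "norm (h p) \<le> norm (h x) \<longleftrightarrow> norm p \<le> norm x" if "x \<in> P" "x \<in> B" "p \<in> B" for x
    using assms that unfolding cycle_iso_def same_branch_def by blast
  have Q: "Q = h ` P" using assms(1) by (simp add: cycle_iso_def)
  show ?thesis
    unfolding closest_def Q using assms(3) mem ord by auto
qed

lemma canonical_labelling_iso:
  assumes "is_cycle F P" "cycle_iso F P G Q h"
  shows "canonical_labelling G Q b \<longleftrightarrow> canonical_labelling F P b"
proof -
  have "(\<exists>p. closest Q (b i) p \<and> G p \<in> b (Suc i mod 3)) \<longleftrightarrow>
      (\<exists>p. closest P (b i) p \<and> F p \<in> b (Suc i mod 3))"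
    if "bij_betw b {..<3} branches" "i < 3" for i
  proof -
    have B: "b i \<in> branches" "b (Suc i mod 3) \<in> branches"
      using that by (auto dest!: bij_betwE)
    have key: "closest Q (b i) (h p) \<and> G (h p) \<in> b (Suc i mod 3) \<longleftrightarrow>
        closest P (b i) p \<and> F p \<in> b (Suc i mod 3)" if "p \<in> P" for p
      using closest_iso[OF assms(2) B(1) that] assms(2) cycle_image[OF assms(1) that] B(2) that
      by (auto simp: cycle_iso_def)
    have "Q = h ` P" using assms(2) by (simp add: cycle_iso_def)
    then show ?thesis using key unfolding closest_def by blast
  qed
  then show ?thesis unfolding canonical_labelling_iff_closest by blast
qed

lemma label_unique:
  assumes "canonical_labelling F P b" "u \<in> triod - {0}"
  shows "\<exists>!i. i < 3 \<and> u \<in> (SOME b. canonical_labelling F P b) i"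
proof -
  define b' where "b' = (SOME b. canonical_labelling F P b)"
  have "canonical_labelling F P b'" unfolding b'_def using assms(1) by (rule someI[of "canonical_labelling F P"])
  then have bij: "bij_betw b' {..<3} branches" by (simp add: canonical_labelling_def)
  obtain B where B: "B \<in> branches" "u \<in> B" using triod_branch assms(2) by blast
  then obtain i where i: "i < 3" "b' i = B" using bij by (metis bij_betw_iff_bijections lessThan_iff)
  have "j = i" if "j < 3" "u \<in> b' j" for j
  proof -
    have "b' j \<in> branches" using bij that(1) by (auto dest!: bij_betwE)
    then have "b' j = b' i" using branch_unique B that(2) i(2) by blast
    then show ?thesis using bij that(1) i(1) by (auto simp: bij_betw_def dest: inj_onD)
  qed
  then show ?thesis unfolding b'_def[symmetric] using i B by blast
qed

lemma label_less:
  assumes "canonical_labelling F P b" "u \<in> triod - {0}"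
  shows "label F P u < 3"
  using theI'[OF label_unique[OF assms]] by (simp add: label_def)

lemma label_same_branch:
  assumes "canonical_labelling F P b" "same_branch u v"
  shows "label F P u = label F P v"
proof -
  have "canonical_labelling F P (SOME b. canonical_labelling F P b)" using assms(1) by (rule someI[of "canonical_labelling F P"])
  then have "(SOME b. canonical_labelling F P b) i \<in> branches" if "i < 3" for i
    using that by (auto simp: canonical_labelling_def dest!: bij_betwE)
  moreover obtain C where "C \<in> branches" "u \<in> C" "v \<in> C"
    using assms(2) by (auto simp: same_branch_def)
  ultimately have "i < 3 \<and> u \<in> (SOME b. canonical_labelling F P b) i \<longleftrightarrow>
      i < 3 \<and> v \<in> (SOME b. canonical_labelling F P b) i" for i
    using branch_unique[of _ C] by metis
  then show ?thesis unfolding label_def by simp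
qed

lemma label_iso:
  assumes "is_cycle F P" "cycle_iso F P G Q h" "canonical_labelling F P b" "u \<in> P"
  shows "label G Q (h u) = label F P u"
proof -
  obtain B where "B \<in> branches" "u \<in> B"
    using triod_branch[of u] cycle_subset[OF assms(1)] assms(4) by auto
  then have "same_branch u (h u)"
    using assms(2,4) unfolding cycle_iso_def same_branch_def by auto
  then have "label F P u = label F P (h u)" by (rule label_same_branch[OF assms(3)])
  also have "\<dots> = label G Q (h u)"
    using canonical_labelling_iso[OF assms(1,2)] by (simp add: label_def)
  finally show ?thesis by simp
qed

lemma displacement_cong_labels:
  "label F P u = label G Q u' \<Longrightarrow> label F P v = label G Q v' \<Longrightarrow>
    displacement F P u v = displacement G Q u' v'"
  by (simp add: displacement_def)

lemma displacement_mod: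
  assumes "label F P u < 3" "label F P v < 3"
  shows "displacement F P u v = real ((label F P v + 3 - label F P u) mod 3) / 3"
proof -
  let ?k = "(label F P v + 3 - label F P u) mod 3"
  have three: "i = 0 \<or> i = 1 \<or> i = 2" if "i < 3" for i :: nat using that by auto
  have "(THE k. k < 3 \<and> label F P v = (label F P u + k) mod 3) = ?k"
  proof (rule the_equality)
    show "?k < 3 \<and> label F P v = (label F P u + ?k) mod 3"
      using three[OF assms(1)] three[OF assms(2)] by auto
    show "k = ?k" if "k < 3 \<and> label F P v = (label F P u + k) mod 3" for k
      using three[OF assms(1)] three[of k] that by auto
  qed
  then show ?thesis by (simp add: displacement_def)
qed

lemma displacement_bounds:
  assumes "label F P u < 3" "label F P v < 3"
  shows "0 \<le> displacement F P u v" "displacement F P u v \<le> 1"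
proof -
  have "(label F P v + 3 - label F P u) mod 3 \<le> 3" by (rule less_imp_le) simp
  then show "0 \<le> displacement F P u v" "displacement F P u v \<le> 1"
    unfolding displacement_mod[OF assms] by auto
qed

text \<open>Up to integers the displacement is the increment of a third of the label; summation along a
  path telescopes, and the displacement of a path between two points of one branch is an integer.\<close>

lemma displacement_label_diff:
  assumes "label F P u < 3" "label F P v < 3"
  shows "\<exists>n::int. displacement F P u v = (real (label F P v) - real (label F P u)) / 3 + of_int n"
proof -
  let ?a = "label F P v + 3 - label F P u"
  have "real ?a = real (?a mod 3) + 3 * real (?a div 3)"
    by (metis mod_mult_div_eq of_nat_add of_nat_mult of_nat_numeral)
  then have "real (?a mod 3) = real ?a - 3 * real (?a div 3)" by simp
  moreover have "real ?a = real (label F P v) + 3 - real (label F P u)" using assms by simp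
  ultimately have "displacement F P u v = (real (label F P v) - real (label F P u)) / 3
      + of_int (1 - int (?a div 3))"
    unfolding displacement_mod[OF assms] by (simp add: field_simps)
  then show ?thesis by blast
qed

lemma path_displacement_label_diff:
  assumes "\<And>i. label F P (w i) < 3"
  shows "\<exists>n::int. (\<Sum>i<m. displacement F P (w i) (w (Suc i))) =
    (real (label F P (w m)) - real (label F P (w 0))) / 3 + of_int n"
proof (induction m)
  case 0
  show ?case by (auto intro: exI[of _ 0])
next
  case (Suc m)
  then obtain n where n: "(\<Sum>i<m. displacement F P (w i) (w (Suc i))) =
    (real (label F P (w m)) - real (label F P (w 0))) / 3 + of_int n" by blast
  obtain n' where n': "displacement F P (w m) (w (Suc m)) =
    (real (label F P (w (Suc m))) - real (label F P (w m))) / 3 + of_int n'"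
    using displacement_label_diff[OF assms assms] by blast
  have "(\<Sum>i<Suc m. displacement F P (w i) (w (Suc i))) =
    (real (label F P (w (Suc m))) - real (label F P (w 0))) / 3 + of_int (n + n')"
    using n n' by (simp add: field_simps)
  then show ?case by blast
qed

text \<open>This form does not refer to a starting point of the orbit, which makes the invariance under equivalence
  of cycles visible.\<close>

lemma rotation_number_sum:
  assumes "is_cycle F P"
  shows "rotation_number F P = (\<Sum>u\<in>P. displacement F P u (F u)) / card P"
proof -
  define x n where "x = (SOME x. x \<in> P)" and "n = card P"
  have x: "x \<in> P" unfolding x_def using cycle_nonempty[OF assms] by (simp add: some_in_eq)
  note orb = cycle_orbit[OF assms x, folded n_def]
  have step: "(F ^^ (Suc i mod n)) x = F ((F ^^ i) x)" if "i < n" for i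
    using that orb(2) by (cases "Suc i = n") auto
  have "(\<Sum>i<length (orbit_loop F P). displacement F P (orbit_loop F P ! i)
        (orbit_loop F P ! (Suc i mod length (orbit_loop F P))))
      = (\<Sum>i<n. displacement F P ((F ^^ i) x) (F ((F ^^ i) x)))"
    by (intro sum.cong) (auto simp: orbit_loop_def step orb(3) simp flip: x_def n_def)
  also have "\<dots> = (\<Sum>u\<in>P. displacement F P u (F u))"
    using sum.reindex_bij_betw[OF orb(1)] by simp
  finally show ?thesis
    by (simp add: rotation_number_def loop_rotation_number_def loop_pair_def orbit_loop_def)
qed

lemma rotation_number_iso:
  assumes "is_cycle F P" "is_cycle G Q" "cycle_iso F P G Q h" "canonical_labelling F P b"
  shows "rotation_number G Q = rotation_number F P"
proof -
  have h: "inj_on h P" "Q = h ` P" "\<And>x. x \<in> P \<Longrightarrow> G (h x) = h (F x)"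
    using assms(3) by (auto simp: cycle_iso_def)
  have "(\<Sum>u\<in>Q. displacement G Q u (G u)) = (\<Sum>u\<in>P. displacement G Q (h u) (h (F u)))"
    unfolding h(2) by (subst sum.reindex[OF h(1)]) (simp add: h(3) flip: h(2))
  also have "\<dots> = (\<Sum>u\<in>P. displacement F P u (F u))"
    using label_iso[OF assms(1,3,4)] cycle_image[OF assms(1)]
    by (intro sum.cong refl displacement_cong_labels) auto
  finally have sums: "(\<Sum>u\<in>Q. displacement G Q u (G u)) = (\<Sum>u\<in>P. displacement F P u (F u))" .
  have "card Q = card P" using h(1,2) by (simp add: card_image)
  then show ?thesis
    unfolding rotation_number_sum[OF assms(1)] rotation_number_sum[OF assms(2)] sums by simp
qed

lemma P_linear_cycle:
  assumes "is_cycle F P" "P_linear F P f"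
  shows "is_cycle f P"
proof -
  from assms(1) obtain x n where x: "n > 0" "(F ^^ n) x = x" "P = range (\<lambda>k. (F ^^ k) x)"
    by (auto simp: is_cycle_def)
  have "x \<in> P" using x by (auto intro: range_eqI[of _ _ 0])
  have "(f ^^ k) x = (F ^^ k) x" for k
    by (induction k) (use assms cycle_funpow[OF assms(1) \<open>x \<in> P\<close>] in \<open>auto simp: P_linear_def\<close>)
  then show ?thesis
    using assms x unfolding is_cycle_def P_linear_def by (intro conjI exI[of _ x] exI[of _ n]) auto
qed

text \<open>Replacing the starting point \<open>y\<close> of the orbit segment by the farther point \<open>x\<close> keeps the first arrow, since
  \<open>y\<close> itself witnesses \<open>x \<rightarrow> f y\<close>, and closes the segment without changing its displacement. The loop is formed in
  an isomorphic cycle \<open>Q\<close>, because the frontier condition is about a cycle equivalent to \<open>P\<close>.\<close>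

lemma loop_of_closer_point:
  assumes F: "is_cycle F P" and G: "is_cycle G Q" and h: "cycle_iso F P G Q h"
    and b: "canonical_labelling F P b"
    and xy: "x \<in> P" "y \<in> P" "same_branch x y" "norm y \<le> norm x"
    and m: "m > 0" "(F ^^ m) y = x"
  shows "\<exists>vs. is_loop G Q vs \<and> loop_rotation_number G Q vs =
    (\<Sum>i<m. displacement F P ((F ^^ i) y) ((F ^^ Suc i) y)) / m"
proof -
  \<comment> \<open>the orbit segment from \<open>y\<close>, with \<open>y\<close> replaced by \<open>x\<close>\<close>
  define w where "w i = h (if i = 0 then x else (F ^^ i) y)" for i
  define vs where "vs = map w [0..<m]"
  have yP: "(F ^^ i) y \<in> P" for i by (rule cycle_funpow[OF F xy(2)])
  have hP: "\<And>u. u \<in> P \<Longrightarrow> h u \<in> Q" "\<And>u. u \<in> P \<Longrightarrow> h (F u) = G (h u)" "Q \<subseteq> triod"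
    using h cycle_subset[OF G] by (auto simp: cycle_iso_def)
  have len: "length vs = m" by (simp add: vs_def)
  have nth: "vs ! i = w i" if "i < m" for i using that by (simp add: vs_def)
  have next_nth: "vs ! (Suc i mod m) = h ((F ^^ Suc i) y)" if "i < m" for i
    using that m nth[of "Suc i mod m"] by (cases "Suc i = m") (auto simp: w_def)
  have lab: "label G Q (w i) = label F P ((F ^^ i) y)" for i
    using label_iso[OF F h b] yP[of i] xy label_same_branch[OF b xy(3)] by (cases i) (auto simp: w_def)
  have "arrow G (vs ! i) (vs ! (Suc i mod m))" if i: "i < m" for i
  proof -
    have "farther_eq (w i) (h ((F ^^ i) y))"
    proof (cases "i = 0")
      case True
      obtain B where B: "B \<in> branches" "x \<in> B" "y \<in> B" using xy(3) by (auto simp: same_branch_def)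
      have hB: "h x \<in> B" "h y \<in> B" using h B xy by (auto simp: cycle_iso_def)
      have "norm (h y) \<le> norm (h x)"
        using h xy B unfolding cycle_iso_def same_branch_def by blast
      then have "norm (h y) < norm (h x) \<or> h x = h y"
        using branch_eq_if_norm_eq[OF B(1) hB] by linarith
      then show ?thesis using True hB B(1) by (auto simp: w_def farther_eq_def farther_def same_branch_def)
    qed (simp add: w_def farther_eq_def)
    moreover have "G (h ((F ^^ i) y)) = h ((F ^^ Suc i) y)" using hP(2)[OF yP[of i]] by simp
    moreover have "h ((F ^^ i) y) \<in> triod" using hP yP by blast
    ultimately show ?thesis
      unfolding arrow_def nth[OF i] next_nth[OF i] farther_eq_def by auto
  qed
  moreover have "set vs \<subseteq> Q" using hP(1) yP xy(1) by (auto simp: vs_def w_def)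
  ultimately have "is_loop G Q vs" using m(1) len by (auto simp: is_loop_def)
  moreover have "(\<Sum>i<m. displacement G Q (vs ! i) (vs ! (Suc i mod m))) =
      (\<Sum>i<m. displacement F P ((F ^^ i) y) ((F ^^ Suc i) y))"
  proof (rule sum.cong)
    fix i assume "i \<in> {..<m}"
    then have i: "i < m" by simp
    show "displacement G Q (vs ! i) (vs ! (Suc i mod m)) = displacement F P ((F ^^ i) y) ((F ^^ Suc i) y)"
      unfolding nth[OF i] next_nth[OF i] using lab label_iso[OF F h b yP]
      by (intro displacement_cong_labels)
  qed simp
  ultimately show ?thesis
    by (intro exI[of _ vs]) (simp add: loop_rotation_number_def loop_pair_def len)
qed

text \<open>The rotation number is the same for all cycles of the pattern, so \<open>pattern_rotation_number\<close> is the
  rotation number of \<open>P\<close>. Rotation numbers of loops lie in \<open>[0,1]\<close>, so the end-points of the rotation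
  interval really are bounds.\<close>

lemma frontier_imp_loop_bound:
  assumes F: "is_cycle F P" and reg: "regular_pattern (pattern_of F P)"
    and front: "frontier_pattern (pattern_of F P)"
  shows "\<exists>G Q h. is_cycle G Q \<and> cycle_iso F P G Q h \<and>
    ((\<forall>vs. is_loop G Q vs \<longrightarrow> rotation_number F P \<le> loop_rotation_number G Q vs) \<or>
     (\<forall>vs. is_loop G Q vs \<longrightarrow> loop_rotation_number G Q vs \<le> rotation_number F P))"
proof -
  let ?A = "pattern_of F P"
  obtain b where b: "canonical_labelling F P b" using regular_imp_canonical[OF F reg] by blast
  have bij: "bij_betw b {..<3} branches" using b by (simp add: canonical_labelling_def)
  have B01: "b 0 \<in> branches" "b 1 \<in> branches" using bij by (auto dest!: bij_betwE)
  have ne: "b 0 \<noteq> b 1" using bij inj_onD[of b "{..<3}" 0 1] by (auto simp: bij_betw_def)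
  have "\<exists>p. p \<in> P \<and> p \<in> b i" if "i < 3" for i
    using b that unfolding canonical_labelling_def by blast
  from this[of 0] this[of 1] obtain p0 p1 where "p0 \<in> P" "p0 \<in> b 0" "p1 \<in> P" "p1 \<in> b 1" by auto
  then have zero: "0 \<in> triod_hull P" using zero_in_triod_hull B01 ne by metis
  have rot: "rotation_number G Q = rotation_number F P" if GQ: "(G, Q) \<in> ?A" for G Q
  proof -
    obtain h where "cycle_iso F P G Q h" using cycle_equiv_imp_iso[OF GQ zero] by blast
    moreover have "is_cycle G Q" using GQ by (auto simp: pattern_of_def cycle_equiv_def)
    ultimately show ?thesis using rotation_number_iso F b by blast
  qed
  have "pattern_rotation_number ?A = rotation_number F P"
    unfolding pattern_rotation_number_def
  proof (rule the_equality)
    show "\<forall>(f, Q)\<in>?A. rotation_number f Q = rotation_number F P" by clarify (rule rot)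
    show "r = rotation_number F P" if "\<forall>(f, Q)\<in>?A. rotation_number f Q = r" for r
      using bspec[OF that pattern_of_self[OF F]] by simp
  qed
  then obtain F' Q G where Q: "(F', Q) \<in> ?A" "P_linear F' Q G"
    "rotation_number F P \<in> {Inf (rotation_interval G Q), Sup (rotation_interval G Q)}"
    using front unfolding frontier_pattern_def by auto
  have F': "is_cycle F' Q" using Q(1) by (auto simp: pattern_of_def cycle_equiv_def)
  have G: "is_cycle G Q" by (rule P_linear_cycle[OF F' Q(2)])
  obtain h where "cycle_iso F P F' Q h" using cycle_equiv_imp_iso[OF Q(1) zero] by blast
  then have h: "cycle_iso F P G Q h"
    using cycle_iso_cong[of P F F Q G F'] Q(2) by (auto simp: P_linear_def)
  have b': "canonical_labelling G Q b" using canonical_labelling_iso[OF F h] b by simp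
  let ?L = "loop_rotation_number G Q ` {vs. is_loop G Q vs}"
  have "?L \<subseteq> {0..1}"
  proof clarify
    fix vs assume vs: "is_loop G Q vs"
    let ?n = "length vs"
    have n: "?n > 0" using vs by (auto simp: is_loop_def)
    have "vs ! i \<in> triod - {0}" if "i < ?n" for i
      using vs cycle_subset[OF G] that nth_mem unfolding is_loop_def by blast
    then have lab: "label G Q (vs ! i) < 3" if "i < ?n" for i
      using label_less[OF b'] that by blast
    let ?s = "\<Sum>i<?n. displacement G Q (vs ! i) (vs ! (Suc i mod ?n))"
    have "0 \<le> ?s" using lab n by (intro sum_nonneg displacement_bounds) auto
    moreover have "?s \<le> (\<Sum>i<?n. 1)" using lab n by (intro sum_mono displacement_bounds) auto
    ultimately show "loop_rotation_number G Q vs \<in> {0..1}"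
      using n by (simp add: loop_rotation_number_def loop_pair_def)
  qed
  then have I: "rotation_interval G Q \<subseteq> {0..1}"
    unfolding rotation_interval_def by (rule closure_minimal) simp
  have bdd: "bdd_below (rotation_interval G Q)" "bdd_above (rotation_interval G Q)"
    using bdd_below_mono[OF bdd_below_Icc I] bdd_above_mono[OF bdd_above_Icc I] .
  have mem: "loop_rotation_number G Q vs \<in> rotation_interval G Q" if "is_loop G Q vs" for vs
    unfolding rotation_interval_def by (rule subsetD[OF closure_subset]) (use that in simp)
  have "(\<forall>vs. is_loop G Q vs \<longrightarrow> rotation_number F P \<le> loop_rotation_number G Q vs) \<or>
     (\<forall>vs. is_loop G Q vs \<longrightarrow> loop_rotation_number G Q vs \<le> rotation_number F P)"
    using Q(3) cInf_lower[OF mem bdd(1)] cSup_upper[OF mem bdd(2)] by auto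
  then show ?thesis using G h by blast
qed

lemma rotation_number_P_linear:
  assumes F: "is_cycle F P" and reg: "regular_pattern (pattern_of F P)" and f: "P_linear F P f"
  shows "rotation_number f P = rotation_number F P"
proof -
  obtain b where b: "canonical_labelling F P b" using regular_imp_canonical[OF F reg] by blast
  have "cycle_iso F P f P id" using f by (auto simp: cycle_iso_def P_linear_def)
  then show ?thesis by (rule rotation_number_iso[OF F P_linear_cycle[OF F f] _ b])
qed

text \<open>The sign \<open>s\<close> is \<open>-1\<close> if the rotation number is the left end-point of the rotation interval
  (the code then decreases with the distance from \<open>0\<close>), and \<open>1\<close> if it is the right one.\<close>

lemma code_monotone_on_branches:
  assumes F: "is_cycle F P" and reg: "regular_pattern (pattern_of F P)"
    and front: "frontier_pattern (pattern_of F P)"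
    and f: "P_linear F P f" and x0: "x0 \<in> P" and code: "code_function f P x0 \<psi>"
  shows "\<exists>s\<in>{1, -1::real}. \<forall>x\<in>P. \<forall>y\<in>P. same_branch x y \<longrightarrow> norm y \<le> norm x \<longrightarrow> s * \<psi> y \<le> s * \<psi> x"
proof -
  have cyc: "is_cycle f P" by (rule P_linear_cycle[OF F f])
  obtain b0 where b0: "canonical_labelling F P b0" using regular_imp_canonical[OF F reg] by blast
  have fF: "f x = F x" if "x \<in> P" for x using f that by (simp add: P_linear_def)
  have id: "cycle_iso F P f P id" using fF by (auto simp: cycle_iso_def)
  have b: "canonical_labelling f P b0" using canonical_labelling_iso[OF F id] b0 by simp
  define r where "r = rotation_number f P"
  have r: "r = rotation_number F P" unfolding r_def by (rule rotation_number_P_linear[OF F reg f])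
  define d where "d u v = displacement f P u v" for u v
  have lab: "label f P ((f ^^ i) x) < 3" if "x \<in> P" for i x
    using label_less[OF b] cycle_funpow[OF cyc that] cycle_subset[OF cyc] by blast
  have step: "\<exists>m>0. (f ^^ m) y = x \<and>
      \<psi> x = \<psi> y + real m * r - (\<Sum>i<m. d ((f ^^ i) y) ((f ^^ Suc i) y))"
    if xy: "x \<in> P" "y \<in> P" "same_branch x y" for x y
  proof -
    obtain j where j: "y = (f ^^ j) x0" using cycle_orbit(4)[OF cyc x0] xy(2) by blast
    obtain m' where m': "x = (f ^^ m') y" using cycle_orbit(4)[OF cyc xy(2)] xy(1) by blast
    \<comment> \<open>one more turn around the cycle makes \<open>m\<close> positive also when \<open>x = y\<close>\<close>
    define m where "m = m' + card P"
    have m: "m > 0" "(f ^^ m) y = x"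
      using cycle_orbit(2,3)[OF cyc xy(2)] m' by (auto simp: m_def funpow_add)
    let ?t = "\<lambda>k. \<Sum>i<k. d ((f ^^ i) x0) ((f ^^ Suc i) x0)"
    let ?s = "\<Sum>i<m. d ((f ^^ i) y) ((f ^^ Suc i) y)"
    have shift: "(f ^^ (j + i)) x0 = (f ^^ i) y" for i
      unfolding j by (simp add: add.commute[of j] funpow_add)
    have "?t (j + m) = ?t j + (\<Sum>i<m. d ((f ^^ (j + i)) x0) ((f ^^ Suc (j + i)) x0))"
      using sum.atLeastLessThan_concat[of 0 j "j + m" "\<lambda>i. d ((f ^^ i) x0) ((f ^^ Suc i) x0)"]
        sum.shift_bounds_nat_ivl[of "\<lambda>i. d ((f ^^ i) x0) ((f ^^ Suc i) x0)" 0 j m]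
      by (simp add: atLeast0LessThan add.commute del: funpow.simps)
    also have "(\<Sum>i<m. d ((f ^^ (j + i)) x0) ((f ^^ Suc (j + i)) x0)) = ?s"
      by (rule sum.cong) (use shift in \<open>auto simp flip: add_Suc_right simp del: funpow.simps\<close>)
    finally have t: "?t (j + m) = ?t j + ?s" .
    obtain n :: int where "?s = (real (label f P ((f ^^ m) y)) - real (label f P ((f ^^ 0) y))) / 3 + of_int n"
      using path_displacement_label_diff[of f P "\<lambda>i. (f ^^ i) y" m] lab[OF xy(2)] unfolding d_def by blast
    then have n: "?s = of_int n" using label_same_branch[OF b xy(3)] m(2) by simp
    have psi: "\<psi> ((f ^^ k) x0) = real k * r - of_int \<lfloor>?t k\<rfloor>" for k
      using code unfolding code_function_def r_def d_def by blast
    have "\<psi> x = real (j + m) * r - of_int \<lfloor>?t (j + m)\<rfloor>"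
      using psi[of "j + m"] shift[of m] m(2) by simp
    also have "\<dots> = (real j * r - of_int \<lfloor>?t j\<rfloor>) + real m * r - of_int n"
      unfolding t n by (simp add: algebra_simps)
    also have "\<dots> = \<psi> y + real m * r - ?s" using psi[of j] j n by simp
    finally show ?thesis using m by blast
  qed
  obtain G Q h where G: "is_cycle G Q" and h0: "cycle_iso F P G Q h" and bound:
    "(\<forall>vs. is_loop G Q vs \<longrightarrow> r \<le> loop_rotation_number G Q vs) \<or>
     (\<forall>vs. is_loop G Q vs \<longrightarrow> loop_rotation_number G Q vs \<le> r)"
    using frontier_imp_loop_bound[OF F reg front] unfolding r by blast
  have h: "cycle_iso f P G Q h" using cycle_iso_cong[of P f F Q G G h] fF h0 by simp
  have main: "\<exists>m>0. \<exists>vs. is_loop G Q vs \<and> \<psi> x - \<psi> y = real m * (r - loop_rotation_number G Q vs)"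
    if xy: "x \<in> P" "y \<in> P" "same_branch x y" "norm y \<le> norm x" for x y
  proof -
    obtain m where m: "m > 0" "(f ^^ m) y = x"
      "\<psi> x = \<psi> y + real m * r - (\<Sum>i<m. d ((f ^^ i) y) ((f ^^ Suc i) y))"
      using step[OF xy(1-3)] by blast
    obtain vs where vs: "is_loop G Q vs" "loop_rotation_number G Q vs =
      (\<Sum>i<m. d ((f ^^ i) y) ((f ^^ Suc i) y)) / m"
      using loop_of_closer_point[OF cyc G h b xy m(1,2)] unfolding d_def by blast
    have "\<psi> x - \<psi> y = real m * (r - loop_rotation_number G Q vs)"
      unfolding vs(2) right_diff_distrib using m(1,3) by (simp del: funpow.simps)
    then show ?thesis using m(1) vs(1) by blast
  qed
  from bound show ?thesis
  proof
    assume lower: "\<forall>vs. is_loop G Q vs \<longrightarrow> r \<le> loop_rotation_number G Q vs"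
    have "\<psi> x \<le> \<psi> y" if xy: "x \<in> P" "y \<in> P" "same_branch x y" "norm y \<le> norm x" for x y
    proof -
      obtain m vs where "is_loop G Q vs" "\<psi> x - \<psi> y = real m * (r - loop_rotation_number G Q vs)"
        using main[OF xy] by blast
      moreover from this have "real m * (r - loop_rotation_number G Q vs) \<le> 0"
        using lower by (intro mult_nonneg_nonpos) auto
      ultimately show ?thesis by simp
    qed
    then show ?thesis by (intro bexI[of _ "-1"]) auto
  next
    assume upper: "\<forall>vs. is_loop G Q vs \<longrightarrow> loop_rotation_number G Q vs \<le> r"
    have "\<psi> y \<le> \<psi> x" if xy: "x \<in> P" "y \<in> P" "same_branch x y" "norm y \<le> norm x" for x y
    proof -
      obtain m vs where "is_loop G Q vs" "\<psi> x - \<psi> y = real m * (r - loop_rotation_number G Q vs)"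
        using main[OF xy] by blast
      moreover from this have "0 \<le> real m * (r - loop_rotation_number G Q vs)"
        using upper by (intro mult_nonneg_nonneg) auto
      ultimately show ?thesis by simp
    qed
    then show ?thesis by (intro bexI[of _ 1]) auto
  qed
qed

section \<open>Monotone interpolation on the triod\<close>

text \<open>Points are added from left to right: the interpolation found so far is frozen beyond its last node \<open>a\<close>, and
  a linear ramp starting at \<open>a\<close> supplies the increment up to the new node.\<close>

lemma mono_interpolation:
  fixes A :: "real set" and u :: "real \<Rightarrow> real"
  assumes "finite A" "mono_on A u"
  shows "\<exists>g. continuous_on UNIV g \<and> mono g \<and> (\<forall>a\<in>A. g a = u a)"
  using assms
proof (induction A rule: finite_linorder_max_induct)
  case empty
  show ?case by (intro exI[of _ "\<lambda>_. 0"]) (auto simp: mono_def)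
next
  case (insert b A)
  from insert.prems have "mono_on A u" by (rule mono_on_subset) auto
  then obtain g where g: "continuous_on UNIV g" "mono g" "\<forall>a\<in>A. g a = u a"
    using insert.IH by blast
  show ?case
  proof (cases "A = {}")
    case True
    then show ?thesis by (intro exI[of _ "\<lambda>_. u b"]) (auto simp: mono_def)
  next
    case False
    define a where "a = Max A"
    have a: "a \<in> A" "\<And>x. x \<in> A \<Longrightarrow> x \<le> a" using False insert.hyps(1) by (auto simp: a_def)
    have ab: "a < b" using insert.hyps(2) a(1) by blast
    have "u a \<le> u b" using insert.prems a(1) ab by (auto simp: mono_on_def)
    then have c: "0 \<le> (u b - u a) / (b - a)" using ab by simp
    define g' where "g' t = g (min t a) + (u b - u a) / (b - a) * max 0 (t - a)" for t
    have "continuous_on UNIV g'"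
      unfolding g'_def using g(1)
      by (intro continuous_intros continuous_on_compose2[OF g(1)]) auto
    moreover have "mono g'"
    proof (rule monoI)
      fix s t :: real assume "s \<le> t"
      then have "g (min s a) \<le> g (min t a)" by (intro monoD[OF g(2)]) auto
      moreover have "(u b - u a) / (b - a) * max 0 (s - a) \<le> (u b - u a) / (b - a) * max 0 (t - a)"
        using \<open>s \<le> t\<close> by (intro mult_left_mono c) auto
      ultimately show "g' s \<le> g' t" unfolding g'_def by (rule add_mono)
    qed
    moreover have "g' x = u x" if "x \<in> insert b A" for x
    proof (cases "x = b")
      case True
      then show ?thesis using ab g(3) a(1) by (simp add: g'_def)
    next
      case False
      then show ?thesis using that a(2) g(3) by (simp add: g'_def)
    qed
    ultimately show ?thesis by blast
  qed
qed

text \<open>The value \<open>0\<close> at \<open>0\<close> lets the interpolations on the three branches be glued at the branching point. It may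
  destroy monotonicity only before the first node \<open>m\<close>, where the value at \<open>m\<close> is multiplied by \<open>t / m\<close>.\<close>

lemma mono_interpolation_vanishing:
  fixes A :: "real set" and u :: "real \<Rightarrow> real"
  assumes "finite A" "A \<subseteq> {0<..}" "mono_on A u"
  shows "\<exists>g. continuous_on UNIV g \<and> g 0 = 0 \<and> (\<forall>a\<in>A. g a = u a) \<and>
    (\<forall>a\<in>A. \<forall>s t. a \<le> s \<longrightarrow> s \<le> t \<longrightarrow> g s \<le> g t)"
proof (cases "A = {}")
  case False
  obtain g where g: "continuous_on UNIV g" "mono g" "\<forall>a\<in>A. g a = u a"
    using mono_interpolation assms by blast
  define m where "m = Min A"
  have m: "m > 0" "\<And>x. x \<in> A \<Longrightarrow> m \<le> x" using assms(1,2) False by (auto simp: m_def)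
  define g' where "g' t = g (max t m) * min 1 (t / m)" for t
  have ge: "g' t = g t" if "m \<le> t" for t
    using that m(1) by (simp add: g'_def max_def min_def)
  have "continuous_on UNIV g'"
    unfolding g'_def using m(1)
    by (intro continuous_intros continuous_on_compose2[OF g(1)]) auto
  moreover have "g' 0 = 0" by (simp add: g'_def)
  moreover have "g' s \<le> g' t" if "a \<in> A" "a \<le> s" "s \<le> t" for a s t
    using ge[of s] ge[of t] m(2)[of a] that monoD[OF g(2) that(3)] by simp
  ultimately show ?thesis using ge m(2) g(3) by (intro exI[of _ g']) auto
qed (auto intro: exI[of _ "\<lambda>_. 0"])

text \<open>Summing \<open>g e (along e z)\<close> over the three directions glues the branch functions: on each branch all
  terms but one vanish.\<close>

lemma mono_interpolation_triod:
  fixes u :: "complex \<Rightarrow> real"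
  assumes "finite P" "P \<subseteq> triod - {0}"
    and mono: "\<And>x y. x \<in> P \<Longrightarrow> y \<in> P \<Longrightarrow> same_branch x y \<Longrightarrow> norm y \<le> norm x \<Longrightarrow> u y \<le> u x"
  shows "\<exists>\<Psi>. continuous_on triod \<Psi> \<and> (\<forall>x\<in>P. \<Psi> x = u x) \<and>
    (\<forall>B\<in>branches. \<forall>a\<in>P \<inter> B. \<forall>x\<in>B. \<forall>y\<in>B. norm a \<le> norm x \<longrightarrow> norm x \<le> norm y \<longrightarrow> \<Psi> x \<le> \<Psi> y)"
proof -
  define good where "good e g \<longleftrightarrow> continuous_on UNIV g \<and> g 0 = 0 \<and>
    (\<forall>a\<in>P \<inter> ray e. g (norm a) = u a) \<and>
    (\<forall>a\<in>P \<inter> ray e. \<forall>s t. norm a \<le> s \<longrightarrow> s \<le> t \<longrightarrow> g s \<le> g t)"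
    for e and g :: "real \<Rightarrow> real"
  have "\<exists>g. good e g"
    if e: "e ^ 3 = 1" for e
  proof -
    let ?A = "norm ` (P \<inter> ray e)" and ?u = "\<lambda>t. u (of_real t * e)"
    have eq: "of_real (norm a) * e = a" if "a \<in> ray e" for a
      using ray_eq_norm[OF e that] by simp
    have "finite ?A" "?A \<subseteq> {0<..}" using assms(1) norm_ray[OF e] by auto
    moreover have "mono_on ?A ?u"
    proof (rule mono_onI)
      fix s t assume "s \<in> ?A" "t \<in> ?A" "s \<le> t"
      then obtain x y where xy: "x \<in> P" "x \<in> ray e" "s = norm x" "y \<in> P" "y \<in> ray e" "t = norm y" by auto
      have "u x \<le> u y"
        using xy \<open>s \<le> t\<close> e by (intro mono) (auto simp: same_branch_def branches_eq_rays)
      then show "?u s \<le> ?u t" using eq xy by simp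
    qed
    ultimately obtain g where "continuous_on UNIV g" "g 0 = 0" "\<forall>a\<in>?A. g a = ?u a"
      "\<forall>a\<in>?A. \<forall>s t. a \<le> s \<longrightarrow> s \<le> t \<longrightarrow> g s \<le> g t"
      using mono_interpolation_vanishing[of ?A ?u] by blast
    then have "good e g" unfolding good_def using eq by auto
    then show ?thesis by blast
  qed
  then have "\<exists>g. \<forall>e. e ^ 3 = 1 \<longrightarrow> good e (g e)" by metis
  then obtain g where "\<And>e. e ^ 3 = 1 \<Longrightarrow> good e (g e)" by blast
  then have g: "\<And>e. e ^ 3 = 1 \<Longrightarrow> continuous_on UNIV (g e)" "\<And>e. e ^ 3 = 1 \<Longrightarrow> g e 0 = 0"
    "\<And>e a. e ^ 3 = 1 \<Longrightarrow> a \<in> P \<inter> ray e \<Longrightarrow> g e (norm a) = u a"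
    "\<And>e a s t. e ^ 3 = 1 \<Longrightarrow> a \<in> P \<inter> ray e \<Longrightarrow> norm a \<le> s \<Longrightarrow> s \<le> t \<Longrightarrow> g e s \<le> g e t"
    unfolding good_def by blast+
  let ?E = "{e :: complex. e ^ 3 = 1}"
  define \<Psi> where "\<Psi> z = (\<Sum>e\<in>?E. g e (along e z))" for z
  have fin: "finite ?E" by (rule finite_roots_unity) simp
  have \<Psi>: "\<Psi> z = g e (norm z)" if e: "e ^ 3 = 1" "z \<in> ray e" for e z
  proof -
    have "\<Psi> z = (\<Sum>e'\<in>?E. if e' = e then g e (norm z) else 0)"
      unfolding \<Psi>_def using e along_ray along_other_ray g(2) by (intro sum.cong) auto
    then show ?thesis using fin e(1) by simp
  qed
  have "continuous_on triod \<Psi>"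
    unfolding \<Psi>_def
  proof (rule continuous_on_sum)
    fix e :: complex assume "e \<in> ?E"
    then have "continuous_on UNIV (g e)" using g(1) by simp
    then show "continuous_on triod (\<lambda>z. g e (along e z))"
      by (rule continuous_on_compose2[OF _ continuous_on_along[OF continuous_on_id]]) simp
  qed
  moreover have "\<Psi> x = u x" if "x \<in> P" for x
  proof -
    obtain e where "e ^ 3 = 1" "x \<in> ray e" using assms(2) \<open>x \<in> P\<close> triod_iff_ray by blast
    then show ?thesis using \<Psi> g(3) that by simp
  qed
  moreover have "\<Psi> x \<le> \<Psi> y"
    if B: "B \<in> branches" and ax: "a \<in> P \<inter> B" "x \<in> B" "y \<in> B" "norm a \<le> norm x" "norm x \<le> norm y" for B a x y
  proof -
    obtain e where "e ^ 3 = 1" "B = ray e" using B by (auto simp: branches_eq_rays)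
    then show ?thesis using \<Psi> g(4) ax by simp
  qed
  ultimately show ?thesis by blast
qed

section \<open>The circle and the coherent strips\<close>

lemma frac_eq_if_diff_int:
  fixes a b :: real
  assumes "a = b + of_int n"
  shows "frac a = frac b"
  using assms by (simp add: frac_def)

text \<open>Away from the integers \<open>frac\<close> is locally a translation. At an integer, an open set of the circle containing
  \<open>0\<close> pulls back to a neighbourhood of both end-points of \<open>[0,1]\<close>, which covers both sides.\<close>

lemma continuous_map_frac: "continuous_map euclideanreal circle frac"
  unfolding continuous_map_def
proof (intro conjI allI impI)
  show "frac \<in> topspace euclideanreal \<rightarrow> topspace circle"
    by (auto simp: topspace_circle frac_lt_1)
  fix U assume "openin circle U"
  then have "openin (top_of_set {0..1}) {y \<in> {0..1}. frac y \<in> U}" by (simp add: openin_circle)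
  then obtain W where W: "open W" "{y \<in> {0..1}. frac y \<in> U} = {0..1} \<inter> W"
    unfolding openin_open by blast
  have mem: "y \<in> W \<longleftrightarrow> frac y \<in> U" if "0 \<le> y" "y \<le> 1" for y
    using that equalityD1[OF W(2)] equalityD2[OF W(2)] by auto
  have "\<exists>N. open N \<and> x \<in> N \<and> N \<subseteq> {x. frac x \<in> U}" if "frac x \<in> U" for x
  proof -
    define n where "n = \<lfloor>x\<rfloor>"
    have near: "frac y = frac (y - of_int n)" for y :: real
      by (rule frac_eq_if_diff_int[of _ _ n]) simp
    have near': "frac y = frac (y - of_int n + 1)" for y :: real
      by (rule frac_eq_if_diff_int[of _ _ "n - 1"]) simp
    have pre: "open ((\<lambda>y. y - of_int n) -` W)" "open ((\<lambda>y. y - of_int n + 1) -` W)"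
      by (intro open_vimage W(1) continuous_intros)+
    show ?thesis
    proof (cases "x = of_int n")
      case False
      then have x: "of_int n < x" "x < of_int n + 1" unfolding n_def by linarith+
      let ?N = "{of_int n<..<of_int n + 1} \<inter> (\<lambda>y. y - of_int n) -` W"
      have "open ?N" using pre by (intro open_Int) auto
      moreover have "x \<in> ?N" using x mem[of "x - of_int n"] near[of x] that by simp
      moreover have "y \<in> {x. frac x \<in> U}" if "y \<in> ?N" for y
        using mem[of "y - of_int n"] near[of y] that by auto
      ultimately show ?thesis by blast
    next
      case True
      let ?N = "{of_int n - 1<..<of_int n + 1} \<inter> (\<lambda>y. y - of_int n) -` W \<inter> (\<lambda>y. y - of_int n + 1) -` W"
      have "open ?N" using pre by (intro open_Int) auto
      moreover have "x \<in> ?N" using True mem[of 0] mem[of 1] that by simp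
      moreover have "y \<in> {x. frac x \<in> U}" if y: "y \<in> ?N" for y
      proof (cases "of_int n \<le> y")
        case True
        then show ?thesis using mem[of "y - of_int n"] near[of y] y by auto
      next
        case False
        then show ?thesis using mem[of "y - of_int n + 1"] near'[of y] y by auto
      qed
      ultimately show ?thesis by blast
    qed
  qed
  then have "open {x. frac x \<in> U}" by (subst open_subopen) blast
  then show "openin euclideanreal {x \<in> topspace euclideanreal. frac x \<in> U}" by simp
qed

lemma triod_hull_singleton:
  assumes "x \<in> triod - {0}"
  shows "triod_hull {x} = {x}"
proof
  obtain e where e: "e ^ 3 = 1" "x \<in> ray e" using assms triod_iff_ray by blast
  have "triod_hull {x} \<subseteq> {z \<in> ray e. norm x \<le> norm z \<and> norm z \<le> norm x}"
    using norm_ray[OF e] e(2) by (intro triod_hull_ray e(1)) auto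
  also have "\<dots> \<subseteq> {x}"
  proof
    fix z assume "z \<in> {z \<in> ray e. norm x \<le> norm z \<and> norm z \<le> norm x}"
    then have "z \<in> ray e" "norm z = norm x" by auto
    then show "z \<in> {x}" using ray_eq_norm[OF e(1)] e(2) by (metis singletonI)
  qed
  finally show "triod_hull {x} \<subseteq> {x}" .
qed (rule triod_hull_inc)

text \<open>The strip is the hull of an equivalence class, whose innermost and outermost points \<open>a\<close> and \<open>b\<close> are both
  related to a generating point \<open>x\<close>, so that their codes have the integer part of the code of \<open>x\<close>.\<close>

lemma coherent_strip_bounds:
  assumes "finite P" "P \<subseteq> triod - {0}" "S \<in> coherent_strips P \<psi>"
  shows "\<exists>B\<in>branches. \<exists>a\<in>P \<inter> B. \<exists>b\<in>P \<inter> B. \<lfloor>\<psi> a\<rfloor> = \<lfloor>\<psi> b\<rfloor> \<and>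
    S \<subseteq> {z \<in> B. norm a \<le> norm z \<and> norm z \<le> norm b}"
proof -
  obtain x where x: "x \<in> P" "S = triod_hull (strip_rel P \<psi> `` {x})"
    using assms(3) by (auto simp: coherent_strips_def quotient_def)
  define K where "K = strip_rel P \<psi> `` {x}"
  obtain e where e: "e ^ 3 = 1" "x \<in> ray e" using x(1) assms(2) triod_iff_ray by blast
  have B: "ray e \<in> branches" using e(1) by (auto simp: branches_eq_rays)
  have K: "y \<in> P" "y \<in> ray e" "\<lfloor>\<psi> y\<rfloor> = \<lfloor>\<psi> x\<rfloor>" if y: "y \<in> K" for y
  proof -
    show "y \<in> P" using that by (simp add: K_def strip_rel_def)
    obtain B where "B \<in> branches" "x \<in> B" "y \<in> B" using y by (auto simp: K_def strip_rel_def same_branch_def)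
    then show "y \<in> ray e" using branch_unique[of B "ray e" x] B e(2) by simp
    show "\<lfloor>\<psi> y\<rfloor> = \<lfloor>\<psi> x\<rfloor>"
      using that triod_hull_inc[of "{x, y}"] x(1) \<open>y \<in> P\<close> by (auto simp: K_def strip_rel_def)
  qed
  have "finite K" using K(1) assms(1) by (meson finite_subset subsetI)
  have "same_branch x x" using B e(2) by (auto simp: same_branch_def)
  moreover have "triod_hull {x} = {x}" using triod_hull_singleton x(1) assms(2) by blast
  ultimately have "x \<in> K" using x(1) by (simp add: K_def strip_rel_def)
  have "Min (norm ` K) \<in> norm ` K" "Max (norm ` K) \<in> norm ` K"
    using \<open>finite K\<close> \<open>x \<in> K\<close> by (auto intro!: Min_in Max_in)
  then obtain a b where ab: "a \<in> K" "norm a = Min (norm ` K)" "b \<in> K" "norm b = Max (norm ` K)"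
    by auto
  have "norm a \<le> norm y \<and> norm y \<le> norm b" if "y \<in> K" for y
    using that \<open>finite K\<close> by (simp add: ab)
  moreover have "0 < norm a" "norm b \<le> 1"
    using norm_ray[OF e(1) K(2)[OF ab(1)]] norm_ray[OF e(1) K(2)[OF ab(3)]] by auto
  ultimately have "S \<subseteq> {z \<in> ray e. norm a \<le> norm z \<and> norm z \<le> norm b}"
    unfolding x(2) K_def[symmetric] using K(2) by (intro triod_hull_ray e(1)) auto
  moreover have "\<lfloor>\<psi> a\<rfloor> = \<lfloor>\<psi> b\<rfloor>" using K(3) ab by simp
  moreover have "a \<in> P \<inter> ray e" "b \<in> P \<inter> ray e" using K(1,2) ab by auto
  ultimately show ?thesis using B by blast
qed

section \<open>The semiconjugacy to the rotation\<close>

theorem theorem3p13: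
  fixes F f :: "complex \<Rightarrow> complex" and P :: "complex set" and x0 :: complex
    and \<psi> :: "complex \<Rightarrow> real" and k p q :: nat
  assumes "is_cycle F P"
    and "regular_pattern (pattern_of F P)"
    and "strangely_ordered (pattern_of F P)"
    and "coprime p q"
    and "rotation_pair F P = (real (k * p), k * q)"
    and "rotation_number F P = real p / real q"
    and "real p / real q \<noteq> 1 / 3"
    and "P_linear F P f"
    and "x0 \<in> P"
    and "code_function f P x0 \<psi>"
  shows "\<exists>\<Phi>. continuous_map (top_of_set triod) circle \<Phi> \<and>
           (\<forall>x\<in>P. \<Phi> (f x) = frac (\<Phi> x + real p / real q)) \<and>
           (\<forall>S\<in>coherent_strips P \<psi>. monotone_along_branch S \<Phi>)"
proof -
  have cyc: "is_cycle f P" by (rule P_linear_cycle[OF assms(1,8)])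
  note P = cycle_finite[OF cyc] cycle_subset[OF cyc]
  have front: "frontier_pattern (pattern_of F P)" using assms(3) by (simp add: strangely_ordered_def)
  obtain s :: real where s: "s \<in> {1, -1}" and mono: "\<forall>x\<in>P. \<forall>y\<in>P. same_branch x y \<longrightarrow>
      norm y \<le> norm x \<longrightarrow> s * \<psi> y \<le> s * \<psi> x"
    using code_monotone_on_branches[OF assms(1,2) front assms(8,9,10)] by blast
  have ss: "s * (s * t) = t" for t using s by auto
  have "\<exists>\<Psi>. continuous_on triod \<Psi> \<and> (\<forall>x\<in>P. \<Psi> x = s * \<psi> x) \<and>
    (\<forall>B\<in>branches. \<forall>a\<in>P \<inter> B. \<forall>x\<in>B. \<forall>y\<in>B. norm a \<le> norm x \<longrightarrow> norm x \<le> norm y \<longrightarrow> \<Psi> x \<le> \<Psi> y)"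
    by (rule mono_interpolation_triod[OF P]) (use mono in simp)
  then obtain \<Psi> where cont: "continuous_on triod \<Psi>"
    and \<Psi>: "\<forall>x\<in>P. \<Psi> x = s * \<psi> x"
    and \<Psi>_mono: "\<forall>B\<in>branches. \<forall>a\<in>P \<inter> B. \<forall>x\<in>B. \<forall>y\<in>B. norm a \<le> norm x \<longrightarrow>
      norm x \<le> norm y \<longrightarrow> \<Psi> x \<le> \<Psi> y"
    by (elim exE conjE)
  \<comment> \<open>\<open>\<Psi>\<close> extends \<open>s * \<psi>\<close>, so the sign has to be undone first\<close>
  define \<Phi> where "\<Phi> z = frac (s * \<Psi> z)" for z
  have "continuous_map (top_of_set triod) euclideanreal (\<lambda>z. s * \<Psi> z)"
    using cont by (simp add: continuous_on_mult_left)
  then have "continuous_map (top_of_set triod) circle \<Phi>"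
    using continuous_map_compose[OF _ continuous_map_frac] unfolding \<Phi>_def comp_def by fast
  moreover have "\<Phi> (f x) = frac (\<Phi> x + real p / real q)" if x: "x \<in> P" for x
  proof -
    obtain j where j: "x = (f ^^ j) x0" using cycle_orbit(4)[OF cyc assms(9)] x by blast
    define t where "t k = (\<Sum>j<k. displacement f P ((f ^^ j) x0) ((f ^^ Suc j) x0))" for k
    have code: "\<psi> ((f ^^ k) x0) = real k * (real p / real q) - of_int \<lfloor>t k\<rfloor>" for k
      using assms(6,10) rotation_number_P_linear[OF assms(1,2,8)]
      unfolding code_function_def t_def by simp
    have "\<psi> (f x) = \<psi> x + real p / real q + of_int (\<lfloor>t j\<rfloor> - \<lfloor>t (Suc j)\<rfloor>)"
      using code[of "Suc j"] code[of j] j by (simp add: algebra_simps add_divide_distrib)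
    then have "frac (\<psi> (f x)) = frac (\<psi> x + real p / real q)" by (rule frac_eq_if_diff_int)
    also have "\<dots> = frac (frac (\<psi> x) + real p / real q)"
      by (rule frac_eq_if_diff_int[of _ _ "\<lfloor>\<psi> x\<rfloor>"]) (simp add: frac_def)
    finally show ?thesis using \<Psi> x cycle_image[OF cyc x] by (simp add: \<Phi>_def ss)
  qed
  moreover have "monotone_along_branch S \<Phi>" if S: "S \<in> coherent_strips P \<psi>" for S
  proof -
    obtain B a b where B: "B \<in> branches" and ab: "a \<in> P \<inter> B" "b \<in> P \<inter> B" "\<lfloor>\<psi> a\<rfloor> = \<lfloor>\<psi> b\<rfloor>"
      and sub: "S \<subseteq> {z \<in> B. norm a \<le> norm z \<and> norm z \<le> norm b}"
      using coherent_strip_bounds[OF P S] by blast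
    have "\<Phi> z = s * \<Psi> z - of_int \<lfloor>\<psi> a\<rfloor>" if "z \<in> S" for z
    proof -
      have z: "z \<in> B" "norm a \<le> norm z" "norm z \<le> norm b" using that sub by auto
      have "\<Psi> a \<le> \<Psi> z" "\<Psi> z \<le> \<Psi> b"
        using \<Psi>_mono B ab z by auto
      then have "s * \<psi> a \<le> \<Psi> z" "\<Psi> z \<le> s * \<psi> b" using \<Psi> ab by auto
      then have "(\<psi> a \<le> s * \<Psi> z \<and> s * \<Psi> z \<le> \<psi> b) \<or> (\<psi> b \<le> s * \<Psi> z \<and> s * \<Psi> z \<le> \<psi> a)"
        using s by auto
      then have "\<lfloor>s * \<Psi> z\<rfloor> = \<lfloor>\<psi> a\<rfloor>" using ab(3) by linarith
      then show ?thesis by (simp add: \<Phi>_def frac_def)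
    qed
    moreover have "\<Psi> x \<le> \<Psi> y" if "x \<in> S" "y \<in> S" "norm x \<le> norm y" for x y
      using \<Psi>_mono B ab(1) that sub by blast
    ultimately show ?thesis using s unfolding monotone_along_branch_def by auto
  qed
  ultimately show ?thesis by blast
qed

end
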